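(* Let $\varphi \in C$ be non-vanishing on $\mathbb{T}$, let $\theta$ denote the unimodular function in $QC$, unique up to a unimodular multiplicative constant, such that $\varphi H^2=\theta H^2$, and set $u=-\log|\varphi|$. Then, up to a unimodular multiplicative constant, $$\theta= \frac{\varphi}{|\varphi|}e^{i \tilde{u}}.$$ In particular, $\theta \in C$ whenever $\tilde{u} \in C$. In addition, the following assertions hold. (i) If $\varphi \in Lip^\alpha$ for $0< \alpha < 1$, then $\theta \in Lip^\alpha$. (ii) If $\varphi \in A$, then $\theta \in A$.
   Context: $\mathbb{T}$ is the unit circle; $H^2$, $H^\infty$ are the Hardy spaces viewed as subspaces of $L^2(\mathbb{T})$, $L^\infty(\mathbb{T})$. $C$ is the algebra of continuous functions on $\mathbb{T}$; $H^\infty+C=\{f+g:f\in H^\infty,g\in C\}$ and $QC=(H^\infty+C)\cap\overline{(H^\infty+C)}$. A function $\theta$ is unimodular if $|\theta|=1$ a.e. For $\varphi\in C$ non-vanishing (hence invertible in $H^\infty+C$), it is known that there is a unimodular $\theta\in QC$, unique up to a multiplicative constant, with $\varphi H^2=\theta H^2$. For a real-valued $u\in L^2(\mathbb{T})$, $\tilde u$ is its harmonic conjugate on $\mathbb{T}$. $Lip^\alpha$ ($0<\alpha\le1$) is the space of complex-valued functions on $\mathbb{T}$ satisfying a Lipschitz (Hölder) condition of order $\alpha$. $A=H^\infty\cap C$ is the disk algebra. *)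

theory Defs
  imports "HOL-Analysis.Analysis"
begin

text \<open>
  Functions on the unit circle are represented by functions on the complex plane whose values
  off the circle are irrelevant. Elements of the Lebesgue spaces are Borel representatives, and
  equality of such elements is equality almost everywhere.
\<close>

text \<open>Normalised arc length; the underlying space is the unit circle itself.\<close>

definition circle_measure :: "complex measure" where
  "circle_measure =
    distr (uniform_measure lborel {0..2 * pi}) (restrict_space borel (sphere 0 1)) cis"

definition L2_circle :: "(complex \<Rightarrow> complex) set" where
  "L2_circle = {f \<in> borel_measurable circle_measure. integrable circle_measure (\<lambda>z. (norm (f z))\<^sup>2)}"

definition Linf_circle :: "(complex \<Rightarrow> complex) set" where
  "Linf_circle = {f \<in> borel_measurable circle_measure. \<exists>B. AE z in circle_measure. norm (f z) \<le> B}"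

definition fourier_coeff :: "(complex \<Rightarrow> complex) \<Rightarrow> int \<Rightarrow> complex" where
  "fourier_coeff f n = (LINT z|circle_measure. f z * z powi (- n))"

definition H2 :: "(complex \<Rightarrow> complex) set" where
  "H2 = {f \<in> L2_circle. \<forall>n < 0. fourier_coeff f n = 0}"

definition Hinf :: "(complex \<Rightarrow> complex) set" where
  "Hinf = {f \<in> Linf_circle. \<forall>n < 0. fourier_coeff f n = 0}"

definition C_circle :: "(complex \<Rightarrow> complex) set" where
  "C_circle = {f. continuous_on (sphere 0 1) f}"

definition Lip_circle :: "real \<Rightarrow> (complex \<Rightarrow> complex) set" where
  "Lip_circle \<alpha> =
    {f. \<exists>K. \<forall>z \<in> sphere 0 1. \<forall>w \<in> sphere 0 1. norm (f z - f w) \<le> K * norm (z - w) powr \<alpha>}"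

definition disk_algebra :: "(complex \<Rightarrow> complex) set" where
  "disk_algebra = Hinf \<inter> C_circle"

text \<open>
  All Borel representatives of the a.e.-classes of the members of \<open>S\<close>: a measurable function
  belongs to \<open>S\<close>, read as a set of classes, iff it lies in \<open>ae_closure S\<close>.
\<close>

definition ae_closure :: "(complex \<Rightarrow> complex) set \<Rightarrow> (complex \<Rightarrow> complex) set" where
  "ae_closure S = {f \<in> borel_measurable circle_measure. \<exists>g \<in> S. AE z in circle_measure. f z = g z}"

definition Hinf_plus_C :: "(complex \<Rightarrow> complex) set" where
  "Hinf_plus_C = ae_closure {\<lambda>z. f z + g z | f g. f \<in> Hinf \<and> g \<in> C_circle}"

definition QC :: "(complex \<Rightarrow> complex) set" where
  "QC = {f. f \<in> Hinf_plus_C \<and> (\<lambda>z. cnj (f z)) \<in> Hinf_plus_C}"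

definition unimodular :: "(complex \<Rightarrow> complex) \<Rightarrow> bool" where
  "unimodular f \<longleftrightarrow> f \<in> borel_measurable circle_measure \<and> (AE z in circle_measure. norm (f z) = 1)"

definition mult_H2 :: "(complex \<Rightarrow> complex) \<Rightarrow> (complex \<Rightarrow> complex) set" where
  "mult_H2 \<phi> = ae_closure {\<lambda>z. \<phi> z * h z | h. h \<in> H2}"

text \<open>
  \<open>v\<close> represents the harmonic conjugate of \<open>u\<close> on the circle: the Poisson extension of
  \<open>u + \<i> v\<close> to the disk is analytic, and that of \<open>v\<close> vanishes at the origin.
\<close>

definition harmonic_conjugate :: "(complex \<Rightarrow> real) \<Rightarrow> (complex \<Rightarrow> real) \<Rightarrow> bool" where
  "harmonic_conjugate u v \<longleftrightarrow>
     (\<lambda>z. complex_of_real (u z)) \<in> L2_circle \<and>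
     (\<lambda>z. complex_of_real (v z)) \<in> L2_circle \<and>
     (\<lambda>z. complex_of_real (u z) + \<i> * complex_of_real (v z)) \<in> H2 \<and>
     (LINT z|circle_measure. v z) = 0"

end

theory Submission
  imports Defs "HOL-Complex_Analysis.Complex_Analysis"
begin

text \<open>
  From \<open>\<phi> H\<^sup>2 = \<theta> H\<^sup>2\<close> one gets \<open>\<theta> / \<phi> \<in> H\<^sup>\<infinity>\<close> and \<open>\<phi> / \<theta> \<in> H\<^sup>\<infinity>\<close>. If \<open>E\<close> is any other invertible
  element of \<open>H\<^sup>\<infinity>\<close> with \<open>|E| = 1 / |\<phi>|\<close>, then \<open>\<theta> / (\<phi> E)\<close> and its inverse are unimodular
  elements of \<open>H\<^sup>\<infinity>\<close>, hence constant, so \<open>\<theta> = c \<phi> E\<close>. Everything then rests on the choice of \<open>E\<close>.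

  For the formula, \<open>E = exp (u + \<i> v)\<close> with \<open>v\<close> the harmonic conjugate of \<open>u = - ln |\<phi>|\<close>; it lies in
  \<open>H\<^sup>\<infinity>\<close> because the Fejer means of \<open>u + \<i> v\<close> are polynomials with uniformly bounded real part.
  Part (i) is then Privalov's theorem on the conjugate of a Hoelder function. For part (ii), \<open>\<phi>\<close>
  extends to the disc and factors as \<open>b g\<close> with \<open>b\<close> a finite Blaschke product and \<open>g\<close> an invertible
  element of \<open>A\<close>; with \<open>E = 1 / g\<close> one finds \<open>\<theta> = c b\<close>.
\<close>

section \<open>Integration on the unit circle\<close>

text \<open>The spaces are described by Fourier coefficients of boundary functions, so a priori no
  member has values inside the disc. Fejer means bridge the gap. Their kernel is nonnegative with
  integral 1, so averaging against it does not increase the L1 norm, keeps an upper bound on the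
  real part and keeps a Hoelder constant; and when the negative coefficients vanish the means are
  polynomials, to which Cauchy's theorems apply. Results return to the boundary by convergence in
  L1, under which every Fourier coefficient converges. The conjugate of a continuous function can be
  unbounded, which is why exponentials are compared on a half-plane rather than on a bounded set.
  For the same reason part (i) constructs a conjugate itself, by compactness, from estimates that
  depend on the Hoelder data alone and not on the degree of the approximating polynomial, while part
  (ii) avoids conjugates and takes \<open>E\<close> in closed form.\<close>

lemma space_circle [simp]: "space circle_measure = sphere 0 1"
  by (simp add: circle_measure_def space_restrict_space)

lemma sets_circle [measurable_cong]: "sets circle_measure = sets (restrict_space borel (sphere 0 1))"
  by (simp add: circle_measure_def)

lemma cis_measurable_circle:
  "cis \<in> measurable (uniform_measure lborel {0..2 * pi}) (restrict_space borel (sphere 0 1))"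
proof -
  have "cis \<in> borel_measurable borel"
    by (intro borel_measurable_continuous_onI continuous_intros)
  thus ?thesis
    by (intro measurable_restrict_space2) (auto simp: measurable_def)
qed

lemma emeasure_circle: "emeasure circle_measure (sphere 0 1) = 1"
proof -
  have "emeasure circle_measure (sphere 0 1) =
      emeasure (uniform_measure lborel {0..2 * pi}) (cis -` sphere 0 1 \<inter> UNIV)"
    unfolding circle_measure_def
    by (subst emeasure_distr[OF cis_measurable_circle]) (auto simp: sets_restrict_space)
  also have "\<dots> = emeasure (uniform_measure lborel {0..2 * pi}) UNIV"
    by (rule arg_cong[where f = "emeasure _"]) auto
  also have "\<dots> = 1"
    by (subst emeasure_uniform_measure) (auto intro!: ennreal_divide_self)
  finally show ?thesis .
qed

interpretation circle: finite_measure circle_measure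
  by (rule finite_measureI) (simp add: emeasure_circle)

lemma measure_circle [simp]: "measure circle_measure (sphere 0 1) = 1"
  by (simp add: measure_def emeasure_circle)

lemma continuous_measurable_circle:
  "continuous_on (sphere 0 1) f \<Longrightarrow> f \<in> borel_measurable circle_measure"
  using borel_measurable_continuous_on_restrict measurable_cong_sets sets_circle by blast

lemma continuous_integrable_circle:
  fixes f :: "complex \<Rightarrow> 'a::{banach, second_countable_topology}"
  assumes "continuous_on (sphere 0 1) f"
  shows "integrable circle_measure f"
proof -
  have "bounded (f ` sphere 0 1)"
    by (intro compact_imp_bounded compact_continuous_image assms) auto
  then obtain B where "\<forall>z\<in>sphere 0 1. norm (f z) \<le> B" by (auto simp: bounded_iff)
  thus ?thesis
    by (intro circle.integrable_const_bound[where B = B] continuous_measurable_circle assms AE_I2) auto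
qed

text \<open>With \<open>z = cis t\<close> one has \<open>dz / z = \<i> dt\<close>. This is the
  bridge over which Cauchy's formulas evaluate integrals against
  \<open>circle_measure\<close>.\<close>

lemma circle_integral_contour:
  assumes "continuous_on (sphere 0 1) g"
  shows "((\<lambda>z. g z / z) has_contour_integral (2 * pi * \<i> * (LINT z|circle_measure. g z))) (circlepath 0 1)"
proof -
  have gm: "g \<in> borel_measurable (restrict_space borel (sphere 0 1))"
    using assms by (rule borel_measurable_continuous_on_restrict)
  have cgc: "continuous_on UNIV (\<lambda>t. g (cis t))"
    by (intro continuous_on_compose2[OF assms] continuous_intros) auto
  have m2: "(\<lambda>t. g (cis t)) \<in> borel_measurable lborel"
    using borel_measurable_continuous_onI[OF cgc] by simp
  have d: "uniform_measure lborel {0..2*pi} = density lborel (\<lambda>t. ennreal (indicator {0..2*pi} t / (2 * pi)))"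
    unfolding uniform_measure_def
    by (rule density_cong) (auto simp: indicator_def divide_ennreal[symmetric])
  have "(LINT z|circle_measure. g z) = (LINT t|uniform_measure lborel {0..2*pi}. g (cis t))"
    unfolding circle_measure_def by (rule integral_distr[OF cis_measurable_circle gm])
  also have "\<dots> = (LINT t|lborel. (indicator {0..2*pi} t / (2 * pi)) *\<^sub>R g (cis t))"
    unfolding d by (rule integral_density[OF m2]) auto
  also have "\<dots> = (LINT t|lborel. (1 / (2 * pi)) *\<^sub>R (indicator {0..2*pi} t *\<^sub>R g (cis t)))"
    by (intro Bochner_Integration.integral_cong) auto
  also have "\<dots> = (1 / (2 * pi)) *\<^sub>R (LINT t:{0..2*pi}|lborel. g (cis t))"
    unfolding set_lebesgue_integral_def by (rule integral_scaleR_right)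
  also have "(LINT t:{0..2*pi}|lborel. g (cis t)) = integral {0..2*pi} (\<lambda>t. g (cis t))"
    by (intro set_borel_integral_eq_integral borel_integrable_atLeastAtMost')
       (rule continuous_on_subset[OF cgc], simp)
  finally have e: "2 * pi * (LINT z|circle_measure. g z) = integral {0..2*pi} (\<lambda>t. g (cis t))"
    by (simp add: scaleR_conv_of_real)
  have "((\<lambda>t. g (cis t)) has_integral (2 * pi * (LINT z|circle_measure. g z))) {0..2*pi}"
    unfolding e by (intro integrable_integral integrable_continuous_real continuous_on_subset[OF cgc]) auto
  hence "((\<lambda>t. \<i> * g (cis t)) has_integral (\<i> * (2 * pi * (LINT z|circle_measure. g z)))) {0..2*pi}"
    by (rule has_integral_mult_right)
  hence "((\<lambda>z. g z / z) has_contour_integral (\<i> * (2 * pi * (LINT z|circle_measure. g z)))) (part_circlepath 0 1 0 (2*pi))"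
    by (subst has_contour_integral_part_circlepath_iff) (auto simp: mult_ac)
  thus ?thesis
    by (simp add: circlepath_def mult_ac)
qed

lemma mean_value_circle:
  assumes "continuous_on (cball 0 1) f" "f holomorphic_on ball 0 1"
  shows "(LINT z|circle_measure. f z) = f 0"
proof -
  have "((\<lambda>u. f u / (u - 0)) has_contour_integral 2 * complex_of_real pi * \<i> * f 0) (circlepath 0 1)"
    by (intro Cauchy_integral_circlepath assms) auto
  moreover have "((\<lambda>z. f z / z) has_contour_integral (2 * pi * \<i> * (LINT z|circle_measure. f z))) (circlepath 0 1)"
    by (intro circle_integral_contour continuous_on_subset[OF assms(1)]) auto
  ultimately show ?thesis
    using has_contour_integral_unique by fastforce
qed

lemma norm_powi_unit: "norm z = 1 \<Longrightarrow> norm (z powi n) = (1::real)" for z :: complex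
  by (simp add: norm_power_int)

lemma cnj_unit: "norm z = 1 \<Longrightarrow> cnj z = inverse z"
  by (metis complex_div_cnj div_by_1 inverse_eq_divide mult_1 norm_one of_real_1 one_power2 divide_self_if inverse_unique complex_norm_square)

text \<open>Nonnegative powers fall under the mean value property; on the circle a negative power is
  the conjugate of a positive one.\<close>

lemma integral_powi_circle: "(LINT z|circle_measure. z powi n) = (if n = 0 then 1 else 0)"
proof -
  have *: "(LINT z|circle_measure. z ^ k) = (if k = 0 then 1 else 0)" for k :: nat
    by (subst mean_value_circle) (auto intro!: continuous_intros holomorphic_intros)
  show ?thesis
  proof (cases "n \<ge> 0")
    case True
    thus ?thesis using *[of "nat n"] by (simp add: power_int_def)
  next
    case False
    have "(LINT z|circle_measure. z powi n) = (LINT z|circle_measure. cnj (z ^ nat (-n)))"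
      using False by (intro Bochner_Integration.integral_cong) (auto simp: power_int_def cnj_unit)
    also have "\<dots> = cnj (LINT z|circle_measure. z ^ nat (-n))"
      by (rule integral_bounded_linear[OF bounded_linear_cnj])
        (intro continuous_integrable_circle continuous_intros)
    finally show ?thesis using False *[of "nat (-n)"] by simp
  qed
qed

lemma continuous_powi_circle [continuous_intros]:
  "continuous_on (sphere 0 1) (\<lambda>z::complex. z powi n)"
  by (intro continuous_on_power_int continuous_intros) auto

lemma integrable_mult_powi_circle:
  fixes f :: "complex \<Rightarrow> complex"
  assumes "integrable circle_measure f"
  shows "integrable circle_measure (\<lambda>z. f z * z powi n)"
proof (rule Bochner_Integration.integrable_bound[OF assms])
  show "(\<lambda>z. f z * z powi n) \<in> borel_measurable circle_measure"
    by (intro borel_measurable_times borel_measurable_integrable assms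
        continuous_measurable_circle continuous_intros)
qed (auto intro!: AE_I2 simp: norm_mult norm_powi_unit)

section \<open>Fejer means\<close>

text \<open>Written as a squared modulus so that nonnegativity is immediate. Expanding the square
  gives the familiar weights \<open>1 - |n| / N\<close>.\<close>

definition fejer_kernel :: "nat \<Rightarrow> complex \<Rightarrow> complex \<Rightarrow> real" where
  "fejer_kernel N z x = (norm (\<Sum>k<N. (z * cnj x) ^ k))\<^sup>2 / real N"

text \<open>The index \<open>n\<close> occurs as \<open>k - l\<close> exactly \<open>N - |n|\<close>
  times, so this is the Cesaro mean of the Fourier series. The double sum matches the expanded
  square in the kernel without any counting.\<close>

definition fejer_mean :: "nat \<Rightarrow> (complex \<Rightarrow> complex) \<Rightarrow> complex \<Rightarrow> complex" where
  "fejer_mean N f z =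
    (\<Sum>k<N. \<Sum>l<N. fourier_coeff f (int k - int l) * z powi (int k - int l)) / of_nat N"

lemma fejer_kernel_nonneg: "fejer_kernel N z x \<ge> 0"
  by (simp add: fejer_kernel_def)

lemma fejer_kernel_eq:
  assumes "norm z = 1" "norm x = 1"
  shows "complex_of_real (fejer_kernel N z x) =
    (\<Sum>k<N. \<Sum>l<N. z powi (int k - int l) * x powi - (int k - int l)) / of_nat N"
proof -
  have nz: "z \<noteq> 0" "x \<noteq> 0" using assms by auto
  have t: "(z * cnj x) ^ k * cnj ((z * cnj x) ^ l) = z powi (int k - int l) * x powi - (int k - int l)" for k l
    using nz by (simp add: cnj_unit assms power_int_diff power_int_minus field_simps)
  have "complex_of_real ((norm (\<Sum>k<N. (z * cnj x) ^ k))\<^sup>2) =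
      (\<Sum>k<N. (z * cnj x) ^ k) * cnj (\<Sum>k<N. (z * cnj x) ^ k)"
    by (rule complex_norm_square)
  also have "\<dots> = (\<Sum>k<N. \<Sum>l<N. z powi (int k - int l) * x powi - (int k - int l))"
    by (simp only: cnj_sum sum_product t)
  finally show ?thesis by (simp add: fejer_kernel_def)
qed

lemma fejer_mean_kernel:
  assumes z: "norm z = 1" and f: "integrable circle_measure f"
  shows "integrable circle_measure (\<lambda>x. of_real (fejer_kernel N z x) * f x)"
    and "fejer_mean N f z = (LINT x|circle_measure. of_real (fejer_kernel N z x) * f x)"
proof -
  let ?g = "\<lambda>x. (\<Sum>k<N. \<Sum>l<N. z powi (int k - int l) * (f x * x powi - (int k - int l))) / of_nat N"
  have e: "of_real (fejer_kernel N z x) * f x = ?g x" if "x \<in> space circle_measure" for x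
    using that z by (simp add: fejer_kernel_eq sum_distrib_left sum_distrib_right sum_divide_distrib mult_ac)
  have "integrable circle_measure ?g"
    by (intro integrable_divide Bochner_Integration.integrable_sum integrable_mult_right
        integrable_mult_powi_circle f)
  thus "integrable circle_measure (\<lambda>x. of_real (fejer_kernel N z x) * f x)"
    by (subst Bochner_Integration.integrable_cong[OF refl e])
  have "(LINT x|circle_measure. of_real (fejer_kernel N z x) * f x) = integral\<^sup>L circle_measure ?g"
    by (rule Bochner_Integration.integral_cong[OF refl e])
  also have "\<dots> = fejer_mean N f z"
    by (simp add: fejer_mean_def fourier_coeff_def Bochner_Integration.integral_sum
        integrable_mult_powi_circle[OF f] mult.commute)
  finally show "fejer_mean N f z = (LINT x|circle_measure. of_real (fejer_kernel N z x) * f x)" ..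
qed

lemma continuous_fejer_mean [continuous_intros]: "continuous_on (sphere 0 1) (fejer_mean N f)"
  unfolding fejer_mean_def by (cases "N = 0") (auto intro!: continuous_intros)

lemma fourier_coeff_powi: "fourier_coeff (\<lambda>z. z powi m) n = (if m = n then 1 else 0)"
proof -
  have "fourier_coeff (\<lambda>z. z powi m) n = (LINT z|circle_measure. z powi (m - n))"
    unfolding fourier_coeff_def
  proof (intro Bochner_Integration.integral_cong refl)
    fix z :: complex assume "z \<in> space circle_measure"
    hence "z \<noteq> 0" by auto
    thus "z powi m * z powi - n = z powi (m - n)"
      by (simp add: power_int_add[symmetric])
  qed
  thus ?thesis by (simp add: integral_powi_circle)
qed

lemma fejer_kernel_integral:
  assumes "N > 0" "norm z = 1"
  shows "(LINT x|circle_measure. fejer_kernel N z x) = 1" "integrable circle_measure (fejer_kernel N z)"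
proof -
  \<comment> \<open>The constant 1 appears as \<open>z powi 0\<close> so that
    \<open>fourier_coeff_powi\<close> supplies its coefficients.\<close>
  have "fejer_mean N (\<lambda>z. z powi 0) z = 1"
    unfolding fejer_mean_def fourier_coeff_powi using assms by (simp add: if_distrib if_distribR cong: if_cong)
  moreover have "fejer_mean N (\<lambda>z. z powi 0) z = (LINT x|circle_measure. of_real (fejer_kernel N z x))"
    by (subst fejer_mean_kernel) (use assms in \<open>auto\<close>)
  ultimately show "(LINT x|circle_measure. fejer_kernel N z x) = 1"
    by (metis of_real_1 of_real_eq_iff integral_complex_of_real)
  have "integrable circle_measure (\<lambda>x. complex_of_real (fejer_kernel N z x) * 1)"
    by (rule fejer_mean_kernel) (use assms in auto)
  from integrable_Re[OF this] show "integrable circle_measure (fejer_kernel N z)" by simp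
qed

text \<open>Among the pairs \<open>k, l < N\<close> exactly \<open>N - 1\<close> satisfy
  \<open>k = l + 1\<close>; hence the factor \<open>1 - 1 / N\<close>.\<close>

lemma fejer_mean_id:
  assumes "N > 0" "norm z = 1"
  shows "fejer_mean N (\<lambda>x. x) z = (1 - 1 / N) * z"
proof -
  have "fejer_mean N (\<lambda>x. x powi 1) z = (\<Sum>k<N. \<Sum>l<N. if l + 1 = k then z else 0) / N"
    unfolding fejer_mean_def fourier_coeff_powi 
    by (intro arg_cong2[where f = "(/)"] sum.cong refl) auto
  also have "(\<Sum>k<N. \<Sum>l<N. if l + 1 = k then z else 0) = (\<Sum>l<N. \<Sum>k<N. if k = l + 1 then z else 0)"
    by (subst sum.swap) (simp add: eq_commute)
  also have "\<dots> = (\<Sum>l<N. if l < N - 1 then z else 0)"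
    by (intro sum.cong refl) auto
  also have "\<dots> = (\<Sum>l<N - 1. z)"
    by (intro sum.mono_neutral_cong_right) auto
  also have "\<dots> / N = (1 - 1 / N) * z"
    using assms by (simp add: field_simps of_nat_diff)
  finally show ?thesis by simp
qed

text \<open>On the circle the squared distance is \<open>2 - 2 * Re (cnj z * x)\<close>, so only the
  means of 1 and of the identity enter: \<open>2 - 2 * (1 - 1 / N) = 2 / N\<close>. This is the
  quantitative concentration of the kernel at \<open>z\<close>.\<close>

lemma fejer_kernel_second_moment:
  assumes "N > 0" "norm z = 1"
  shows "(LINT x|circle_measure. fejer_kernel N z x * (norm (x - z))\<^sup>2) = 2 / N"
    and "integrable circle_measure (\<lambda>x. fejer_kernel N z x * (norm (x - z))\<^sup>2)"
proof -
  have e: "fejer_kernel N z x * (norm (x - z))\<^sup>2 =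
     2 * fejer_kernel N z x - 2 * Re (cnj z * (of_real (fejer_kernel N z x) * x))" if "x \<in> space circle_measure" for x
  proof -
    have "(norm (x - z))\<^sup>2 = 2 - 2 * Re (cnj z * x)"
      using that assms(2) unfolding cmod_power2 
      by (simp add: norm_eq_1 cmod_def power2_eq_square algebra_simps)
    moreover have "Re (cnj z * (of_real (fejer_kernel N z x) * x)) = fejer_kernel N z x * Re (cnj z * x)"
      by (simp add: algebra_simps)
    ultimately show ?thesis by (simp only: right_diff_distrib mult_ac)
  qed
  have i: "integrable circle_measure (\<lambda>x. complex_of_real (fejer_kernel N z x) * x)"
    by (rule fejer_mean_kernel) (use assms in \<open>auto intro!: continuous_integrable_circle continuous_intros\<close>)
  have j: "integrable circle_measure (\<lambda>x. 2 * fejer_kernel N z x - 2 * Re (cnj z * (of_real (fejer_kernel N z x) * x)))"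
    by (intro Bochner_Integration.integrable_diff integrable_mult_right fejer_kernel_integral assms i integrable_Re)
  thus "integrable circle_measure (\<lambda>x. fejer_kernel N z x * (norm (x - z))\<^sup>2)"
    by (subst Bochner_Integration.integrable_cong[OF refl e])
  have "(LINT x|circle_measure. fejer_kernel N z x * (norm (x - z))\<^sup>2) =
     (LINT x|circle_measure. 2 * fejer_kernel N z x - 2 * Re (cnj z * (of_real (fejer_kernel N z x) * x)))"
    by (rule Bochner_Integration.integral_cong[OF refl e])
  also have "\<dots> = (LINT x|circle_measure. 2 * fejer_kernel N z x) - 
       (LINT x|circle_measure. 2 * Re (cnj z * (of_real (fejer_kernel N z x) * x)))"
    by (intro Bochner_Integration.integral_diff integrable_mult_right fejer_kernel_integral assms i integrable_Re)
  also have "\<dots> = 2 - 2 * Re (cnj z * (LINT x|circle_measure. of_real (fejer_kernel N z x) * x))"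
    unfolding Bochner_Integration.integral_mult_right_zero integral_Re[OF integrable_mult_right[OF i]]
      fejer_kernel_integral[OF assms] by simp
  also have "(LINT x|circle_measure. of_real (fejer_kernel N z x) * x) = (1 - 1 / N) * z"
    by (subst fejer_mean_kernel(2)[symmetric])
      (use assms fejer_mean_id in \<open>auto intro!: continuous_integrable_circle continuous_intros\<close>)
  also have "cnj z * ((1 - 1 / N) * z) = complex_of_real (1 - 1 / N)"
    using complex_norm_square[of z] assms by (simp add: algebra_simps)
  finally show "(LINT x|circle_measure. fejer_kernel N z x * (norm (x - z))\<^sup>2) = 2 / N"
    by simp
qed

text \<open>Since the kernel has integral 1, \<open>c\<close> can be moved under the integral; since
  it is nonnegative, a pointwise majorant then passes through.\<close>

lemma fejer_mean_diff_le:
  assumes N: "N > 0" and z: "norm z = 1" and f: "integrable circle_measure f"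
    and h: "integrable circle_measure (\<lambda>x. fejer_kernel N z x * h x)"
    and le: "\<And>x. norm x = 1 \<Longrightarrow> norm (f x - c) \<le> h x"
  shows "norm (fejer_mean N f z - c) \<le> (LINT x|circle_measure. fejer_kernel N z x * h x)"
proof -
  note K = fejer_kernel_integral[OF N z]
  have "fejer_mean N f z - c = (LINT x|circle_measure. of_real (fejer_kernel N z x) * f x)
        - (LINT x|circle_measure. of_real (fejer_kernel N z x) * c)"
    using K by (simp add: fejer_mean_kernel(2)[OF z f])
  also have "\<dots> = (LINT x|circle_measure. of_real (fejer_kernel N z x) * f x - of_real (fejer_kernel N z x) * c)"
    by (intro Bochner_Integration.integral_diff[symmetric] fejer_mean_kernel z f)
      (use K in auto)
  also have "norm \<dots> \<le> (LINT x|circle_measure. fejer_kernel N z x * h x)"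
  proof (rule Bochner_Integration.integral_norm_bound_integral)
    show "integrable circle_measure (\<lambda>x. of_real (fejer_kernel N z x) * f x - of_real (fejer_kernel N z x) * c)"
      by (intro Bochner_Integration.integrable_diff fejer_mean_kernel z f) (use K in auto)
    show "norm (of_real (fejer_kernel N z x) * f x - of_real (fejer_kernel N z x) * c)
         \<le> fejer_kernel N z x * h x" if "x \<in> space circle_measure" for x
    proof -
      have "norm (of_real (fejer_kernel N z x) * f x - of_real (fejer_kernel N z x) * c) =
        fejer_kernel N z x * norm (f x - c)"
        by (simp flip: right_diff_distrib add: norm_mult fejer_kernel_nonneg)
      thus ?thesis using le[of x] that by (simp add: mult_left_mono fejer_kernel_nonneg)
    qed
  qed (rule h)
  finally show ?thesis .
qed

text \<open>Korovkin's argument: a continuous function satisfies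
  \<open>norm (f x - f z) \<le> \<epsilon> + C * (norm (x - z))\<^sup>2\<close>, and the Fejer means of the right-hand side
  are small at \<open>z\<close>.\<close>

lemma fejer_mean_uniform_limit:
  assumes "continuous_on (sphere 0 1) f"
  shows "uniform_limit (sphere 0 1) (\<lambda>N. fejer_mean N f) f sequentially"
proof (rule uniform_limitI)
  fix e :: real assume e: "e > 0"
  have "bounded (f ` sphere 0 1)"
    by (intro compact_imp_bounded compact_continuous_image assms) auto
  then obtain B where B: "B > 0" "\<And>z. norm z = 1 \<Longrightarrow> norm (f z) \<le> B" by (auto simp: bounded_pos)
  have "uniformly_continuous_on (sphere 0 1) f"
    by (intro compact_uniformly_continuous assms) auto
  then obtain d where d: "d > 0" "\<And>x z. norm x = 1 \<Longrightarrow> norm z = 1 \<Longrightarrow> dist x z < d \<Longrightarrow> dist (f x) (f z) < e / 2"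
    using e unfolding uniformly_continuous_on_def by (metis half_gt_zero mem_sphere_0)
  \<comment> \<open>Chosen for points at distance at least \<open>d\<close>: there the trivial bound
    \<open>2 * B = C * d\<^sup>2\<close> is already below the quadratic term.\<close>
  define C where "C = 2 * B / d\<^sup>2"
  have le: "norm (f x - f z) \<le> e / 2 + C * (norm (x - z))\<^sup>2" if "norm x = 1" "norm z = 1" for x z
  proof (cases "dist x z < d")
    case True
    have "C * (norm (x - z))\<^sup>2 \<ge> 0" using B by (simp add: C_def)
    thus ?thesis using d(2)[OF that True] by (simp add: dist_norm)
  next
    case False
    have "norm (f x - f z) \<le> 2 * B"
      using norm_triangle_ineq4[of "f x" "f z"] B(2)[of x] B(2)[of z] that by linarith
    also have "\<dots> = C * d\<^sup>2" using d by (simp add: C_def)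
    also have "\<dots> \<le> C * (norm (x - z))\<^sup>2"
      using False d B by (intro mult_left_mono power_mono) (auto simp: dist_norm C_def)
    finally show ?thesis using e by simp
  qed
  have "(\<lambda>N. C * (2 / real N)) \<longlonglongrightarrow> 0" by real_asymp
  hence "\<forall>\<^sub>F N in sequentially. C * (2 / real N) < e / 2"
    using e by (intro order_tendstoD) auto
  moreover have "\<forall>\<^sub>F N in sequentially. N > (0::nat)" by (rule eventually_gt_at_top)
  ultimately show "\<forall>\<^sub>F N in sequentially. \<forall>z\<in>sphere 0 1. dist (fejer_mean N f z) (f z) < e"
  proof eventually_elim
    case (elim N)
    show ?case
    proof
      fix z :: complex assume "z \<in> sphere 0 1"
      hence z: "norm z = 1" by simp
      note K = fejer_kernel_integral[OF elim(2) z] fejer_kernel_second_moment[OF elim(2) z]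
      have i: "integrable circle_measure (\<lambda>x. e / 2 * fejer_kernel N z x + C * (fejer_kernel N z x * (norm (x - z))\<^sup>2))"
        by (intro Bochner_Integration.integrable_add integrable_mult_right K)
      have eq: "fejer_kernel N z x * (e / 2 + C * (norm (x - z))\<^sup>2) = e / 2 * fejer_kernel N z x + C * (fejer_kernel N z x * (norm (x - z))\<^sup>2)" for x
        by (simp add: algebra_simps)
      have "norm (fejer_mean N f z - f z) \<le> (LINT x|circle_measure. fejer_kernel N z x * (e / 2 + C * (norm (x - z))\<^sup>2))"
        by (rule fejer_mean_diff_le[OF elim(2) z]) (use le z i eq assms in \<open>auto intro: continuous_integrable_circle\<close>)
      also have "\<dots> = e / 2 * (LINT x|circle_measure. fejer_kernel N z x) + C * (LINT x|circle_measure. fejer_kernel N z x * (norm (x - z))\<^sup>2)"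
        unfolding eq by (subst Bochner_Integration.integral_add) (intro integrable_mult_right K, intro integrable_mult_right K, simp)
      also have "\<dots> < e" unfolding K using elim(1) by simp
      finally show "dist (fejer_mean N f z) (f z) < e" by (simp add: dist_norm)
    qed
  qed
qed

section \<open>Contraction of the Fejer means in L1\<close>

lemma fourier_coeff_diff:
  assumes "integrable circle_measure f" "integrable circle_measure g"
  shows "fourier_coeff (\<lambda>x. f x - g x) n = fourier_coeff f n - fourier_coeff g n"
  unfolding fourier_coeff_def left_diff_distrib
  by (intro Bochner_Integration.integral_diff integrable_mult_powi_circle assms)

lemma fejer_mean_diff:
  assumes "integrable circle_measure f" "integrable circle_measure g"
  shows "fejer_mean N (\<lambda>x. f x - g x) z = fejer_mean N f z - fejer_mean N g z"
  unfolding fejer_mean_def fourier_coeff_diff[OF assms] 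
  by (simp add: left_diff_distrib sum_subtractf diff_divide_distrib)

lemma fejer_mean_norm_le:
  assumes z: "norm z = 1" and f: "integrable circle_measure f"
  shows "norm (fejer_mean N f z) \<le> Re (fejer_mean N (\<lambda>x. of_real (norm (f x))) z)"
proof -
  have nf: "integrable circle_measure (\<lambda>x. complex_of_real (norm (f x)))"
    using f by (intro integrable_of_real integrable_norm)
  note i = fejer_mean_kernel(1)[OF z nf]
  have i': "integrable circle_measure (\<lambda>x. fejer_kernel N z x * norm (f x))"
    using integrable_Re[OF i] by simp
  have "norm (fejer_mean N f z) \<le> (LINT x|circle_measure. fejer_kernel N z x * norm (f x))"
    unfolding fejer_mean_kernel(2)[OF z f]
    by (intro Bochner_Integration.integral_norm_bound_integral fejer_mean_kernel z f i')
       (simp add: norm_mult fejer_kernel_nonneg)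
  also have "\<dots> = Re (fejer_mean N (\<lambda>x. of_real (norm (f x))) z)"
    unfolding fejer_mean_kernel(2)[OF z nf] integral_Re[OF i, symmetric] by simp
  finally show ?thesis .
qed

lemma fejer_mean_integral:
  assumes "N > 0"
  shows "(LINT z|circle_measure. fejer_mean N f z) = fourier_coeff f 0"
proof -
  have "(LINT z|circle_measure. fejer_mean N f z) =
     (\<Sum>k<N. \<Sum>l<N. fourier_coeff f (int k - int l) * (LINT z|circle_measure. z powi (int k - int l))) / of_nat N"
    unfolding fejer_mean_def
    by (simp add: Bochner_Integration.integral_sum continuous_integrable_circle continuous_intros)
  also have "(\<Sum>k<N. \<Sum>l<N. fourier_coeff f (int k - int l) * (LINT z|circle_measure. z powi (int k - int l))) =
     (\<Sum>k<N. \<Sum>l<N. if k = l then fourier_coeff f 0 else 0)"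
    by (intro sum.cong refl) (simp add: integral_powi_circle)
  also have "\<dots> / N = fourier_coeff f 0" using assms by simp
  finally show ?thesis .
qed

lemma integrable_fejer_mean: "integrable circle_measure (fejer_mean N f)"
  by (intro continuous_integrable_circle continuous_intros)

text \<open>The mean of \<open>f\<close> is dominated pointwise by the mean of
  \<open>norm (f x)\<close>, and averaging preserves the zeroth coefficient, which for that function
  is its integral. No exchange of two integrals is needed.\<close>

lemma fejer_mean_L1_contraction:
  assumes N: "N > 0" and f: "integrable circle_measure f"
  shows "(LINT z|circle_measure. norm (fejer_mean N f z)) \<le> (LINT z|circle_measure. norm (f z))"
proof -
  let ?n = "\<lambda>x. complex_of_real (norm (f x))"
  have "(LINT z|circle_measure. norm (fejer_mean N f z)) \<le> (LINT z|circle_measure. Re (fejer_mean N ?n z))"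
    by (intro integral_mono integrable_norm integrable_Re integrable_fejer_mean fejer_mean_norm_le f) auto
  also have "\<dots> = Re (fourier_coeff ?n 0)"
    by (simp add: integrable_fejer_mean integral_Re fejer_mean_integral N)
  also have "\<dots> = (LINT z|circle_measure. norm (f z))"
    by (simp add: fourier_coeff_def)
  finally show ?thesis .
qed

section \<open>Convergence of Fejer means in the mean\<close>

text \<open>Inner regularity is applied to a Borel measure on the plane, namely the push-forward of
  \<open>circle_measure\<close> along the inclusion; on Borel subsets of the circle the two measures
  agree.\<close>

lemma circle_compact_inner:
  assumes A: "A \<in> sets circle_measure" and e: "e > 0"
  obtains K where "compact K" "K \<subseteq> A" "measure circle_measure (A - K) < e"
proof -
  define N where "N = distr circle_measure borel (\<lambda>x. x)"
  have sA: "A \<subseteq> sphere 0 1" using sets.sets_into_space[OF A] by simp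
  have bA: "A \<in> sets borel"
    using A by (simp add: sets_circle sets_restrict_space_iff)
  have sc: "B \<in> sets circle_measure" if "B \<in> sets borel" "B \<subseteq> sphere 0 1" for B
    using that by (simp add: sets_circle sets_restrict_space_iff)
  have m: "(\<lambda>x. x) \<in> measurable circle_measure borel"
    by (intro continuous_measurable_circle continuous_intros)
  have N: "emeasure N B = emeasure circle_measure B" if "B \<in> sets borel" "B \<subseteq> sphere 0 1" for B
    unfolding N_def using that
    by (subst emeasure_distr[OF m]) (auto intro!: arg_cong[where f = "emeasure _"])
  interpret N: finite_measure N
    unfolding N_def by (rule circle.finite_measure_distr[OF m])
  have reg: "emeasure N A = (SUP K\<in>{K. K \<subseteq> A \<and> compact K}. emeasure N K)"
    by (rule inner_regular) (use bA N.emeasure_finite in \<open>auto simp: N_def\<close>)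
  show ?thesis
  proof (cases "emeasure N A = 0")
    case True
    hence "measure circle_measure A = 0" using N[OF bA sA] by (simp add: measure_def)
    thus ?thesis using that[of "{}"] e by simp
  next
    case False
    have "emeasure N A - ennreal e < (SUP K\<in>{K. K \<subseteq> A \<and> compact K}. emeasure N K)"
      unfolding reg[symmetric]
      using False e N.emeasure_finite by (intro ennreal_between) (auto simp: less_top[symmetric] zero_less_iff_neq_zero)
    then obtain K where K: "K \<subseteq> A" "compact K" "emeasure N A - ennreal e < emeasure N K"
      unfolding less_SUP_iff by auto
    have bK: "K \<in> sets borel" using K(2) by (simp add: borel_closed compact_imp_closed)
    have sK: "K \<subseteq> sphere 0 1" using K(1) sA by blast
    have "ennreal (measure circle_measure A) - ennreal e < ennreal (measure circle_measure K)"
      using K(3) N[OF bA sA] N[OF bK sK] by (simp add: circle.emeasure_eq_measure)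
    hence "measure circle_measure A - e < measure circle_measure K"
      using e by (subst (asm) ennreal_minus) (simp, meson ennreal_leI not_le)
    hence "measure circle_measure (A - K) < e"
      using circle.finite_measure_Diff[OF A sc[OF bK sK] K(1)] by simp
    thus ?thesis using that K by blast
  qed
qed

text \<open>Induction over integrable functions reduces the claim to indicators. There a Urysohn
  function is taken between a compact subset of \<open>A\<close> and a compact subset of its
  complement, each almost exhausting its set.\<close>

lemma continuous_dense_L1_circle:
  fixes f :: "complex \<Rightarrow> complex"
  assumes "integrable circle_measure f"
  shows "e > 0 \<Longrightarrow> \<exists>g. continuous_on (sphere 0 1) g \<and> (LINT x|circle_measure. norm (f x - g x)) < e"
  using assms
proof (induction arbitrary: e rule: integrable_induct)
  case (base A c)
  \<comment> \<open>Two exceptional sets of measure below \<open>d\<close> cost at most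
    \<open>norm c * (2 * d)\<close>, which is below \<open>e\<close>; the summand 1 covers
    \<open>c = 0\<close>.\<close>
  define d where "d = e / (norm c + 1) / 2"
  have d: "d > 0" using base by (auto simp: d_def intro!: divide_pos_pos add_nonneg_pos)
  obtain K where K: "compact K" "K \<subseteq> A" "measure circle_measure (A - K) < d"
    using circle_compact_inner[OF base(1) d] .
  have "sphere 0 1 - A \<in> sets circle_measure" using base(1) sets.compl_sets[OF base(1)] by simp
  then obtain L where L: "compact L" "L \<subseteq> sphere 0 1 - A" "measure circle_measure (sphere 0 1 - A - L) < d"
    using circle_compact_inner[OF _ d] by metis
  have sA: "A \<subseteq> sphere 0 1" using sets.sets_into_space[OF base(1)] by simp
  have ms: "K \<in> sets circle_measure" "L \<in> sets circle_measure"
    using K L sA by (auto simp: sets_circle sets_restrict_space_iff borel_closed compact_imp_closed)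
  obtain h :: "complex \<Rightarrow> real" where h: "continuous_on UNIV h" "\<And>x. h x \<in> closed_segment 1 0"
     "\<And>x. x \<in> K \<Longrightarrow> h x = 1" "\<And>x. x \<in> L \<Longrightarrow> h x = 0"
    using Urysohn[of K L 1 0] K L by (metis (no_types, lifting) compact_imp_closed disjoint_iff subsetD DiffD2)
  \<comment> \<open>Off \<open>D\<close> the Urysohn function agrees with the indicator, and on
    \<open>D\<close> the two differ by at most 1.\<close>
  define D where "D = (A - K) \<union> (sphere 0 1 - A - L)"
  have D: "D \<in> sets circle_measure"
    using ms base(1) sets.compl_sets[OF base(1)] by (auto simp: D_def)
  have "measure circle_measure D \<le> measure circle_measure (A - K) + measure circle_measure (sphere 0 1 - A - L)"
    unfolding D_def using ms base(1) sets.compl_sets[OF base(1)] by (intro measure_Un_le) auto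
  hence mD: "measure circle_measure D < 2 * d" using K L by simp
  have ch: "continuous_on (sphere 0 1) (\<lambda>x. h x *\<^sub>R c)"
    by (intro continuous_intros continuous_on_subset[OF h(1)]) auto
  have le: "norm (indicat_real A x *\<^sub>R c - h x *\<^sub>R c) \<le> norm c * indicat_real D x" if "norm x = 1" for x
  proof -
    have "0 \<le> h x" "h x \<le> 1" using h(2)[of x] by (auto simp: closed_segment_eq_real_ivl split: if_splits)
    hence "\<bar>indicat_real A x - h x\<bar> \<le> indicat_real D x"
      using h(3,4)[of x] K(2) L(2) that by (auto simp: D_def indicator_def)
    thus ?thesis by (simp flip: scaleR_diff_left add: mult.commute mult_left_mono)
  qed
  have fin: "emeasure circle_measure B < \<infinity>" for B
    using circle.emeasure_finite[of B] by (simp only: infinity_ennreal_def top.not_eq_extremum)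
  have "(LINT x|circle_measure. norm (indicat_real A x *\<^sub>R c - h x *\<^sub>R c)) \<le> (LINT x|circle_measure. norm c * indicat_real D x)"
  proof (rule integral_mono)
    show "integrable circle_measure (\<lambda>x. norm (indicat_real A x *\<^sub>R c - h x *\<^sub>R c))"
      by (intro integrable_norm Bochner_Integration.integrable_diff continuous_integrable_circle[OF ch]
          integrable_scaleR_left integrable_real_indicator base(1) fin)
    show "integrable circle_measure (\<lambda>x. norm c * indicat_real D x)"
      by (intro integrable_mult_right integrable_real_indicator D fin)
  qed (use le in simp)
  also have "\<dots> = norm c * measure circle_measure D"
    using D sets.sets_into_space[OF D] by (simp add: Int_absorb2)
  also have "\<dots> \<le> norm c * (2 * d)" using mD by (intro mult_left_mono) auto
  also have "\<dots> < e"
  proof -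
    have two: "2 * (x / 2) = x" for x :: real by simp
    have "norm c * (2 * d) = norm c / (norm c + 1) * e"
      unfolding d_def two by simp
    also have "\<dots> < 1 * e"
      using base(3) by (intro mult_strict_right_mono) (simp_all add: divide_less_eq add_nonneg_pos)
    finally show ?thesis by simp
  qed
  finally show ?case using ch by blast
next
  case (add f g)
  obtain f' where f': "continuous_on (sphere 0 1) f'" "(LINT x|circle_measure. norm (f x - f' x)) < e / 2"
    using add.IH(1)[of "e / 2"] add.prems by auto
  obtain g' where g': "continuous_on (sphere 0 1) g'" "(LINT x|circle_measure. norm (g x - g' x)) < e / 2"
    using add.IH(2)[of "e / 2"] add.prems by auto
  note i = add.hyps continuous_integrable_circle[OF f'(1)] continuous_integrable_circle[OF g'(1)]
  have "(LINT x|circle_measure. norm (f x + g x - (f' x + g' x))) \<le>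
     (LINT x|circle_measure. norm (f x - f' x) + norm (g x - g' x))"
    by (intro integral_mono integrable_norm Bochner_Integration.integrable_add Bochner_Integration.integrable_diff i)
       (simp add: add_diff_add norm_triangle_ineq)
  also have "\<dots> = (LINT x|circle_measure. norm (f x - f' x)) + (LINT x|circle_measure. norm (g x - g' x))"
    by (intro Bochner_Integration.integral_add integrable_norm Bochner_Integration.integrable_diff i)
  also have "\<dots> < e" using f' g' by simp
  finally show ?case using f'(1) g'(1) by (intro exI[of _ "\<lambda>x. f' x + g' x"]) (auto intro: continuous_intros)
next
  case (lim f s)
  have "(\<lambda>n. LINT x|circle_measure. norm (f x - s n x)) \<longlonglongrightarrow> (LINT x|circle_measure. norm (f x - f x))"
  \<comment> \<open>The induction rule provides \<open>norm (s n x) \<le> 2 * norm (f x)\<close>,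
    which makes \<open>3 * norm (f x)\<close> a majorant of the difference.\<close>
  proof (rule integral_dominated_convergence[where w = "\<lambda>x. 3 * norm (f x)"])
    show "AE x in circle_measure. (\<lambda>n. norm (f x - s n x)) \<longlonglongrightarrow> norm (f x - f x)"
      by (intro AE_I2 tendsto_intros lim.hyps)
    show "AE x in circle_measure. norm (norm (f x - s n x)) \<le> 3 * norm (f x)" for n
    proof (rule AE_I2)
      fix x assume "x \<in> space circle_measure"
      from lim.hyps(3)[OF this, of n] show "norm (norm (f x - s n x)) \<le> 3 * norm (f x)"
        using norm_triangle_ineq4[of "f x" "s n x"] by simp
    qed
  qed (use lim.hyps in auto)
  hence "\<forall>\<^sub>F n in sequentially. (LINT x|circle_measure. norm (f x - s n x)) < e / 2"
    using lim.prems by (intro order_tendstoD) auto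
  then obtain n where n: "(LINT x|circle_measure. norm (f x - s n x)) < e / 2"
    using eventually_happens'[OF sequentially_bot] by blast
  obtain g where g: "continuous_on (sphere 0 1) g" "(LINT x|circle_measure. norm (s n x - g x)) < e / 2"
    using lim.IH[of "e / 2" n] lim.prems by auto
  note i = lim.hyps(1,4) continuous_integrable_circle[OF g(1)]
  have "(LINT x|circle_measure. norm (f x - g x)) \<le>
     (LINT x|circle_measure. norm (f x - s n x) + norm (s n x - g x))"
    by (intro integral_mono integrable_norm Bochner_Integration.integrable_add Bochner_Integration.integrable_diff i)
       (metis dist_norm dist_triangle)
  also have "\<dots> = (LINT x|circle_measure. norm (f x - s n x)) + (LINT x|circle_measure. norm (s n x - g x))"
    by (intro Bochner_Integration.integral_add integrable_norm Bochner_Integration.integrable_diff i)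
  also have "\<dots> < e" using n g by simp
  finally show ?case using g(1) by blast
qed

text \<open>Approximate \<open>f\<close> in L1 by a continuous \<open>g\<close>. The means of
  \<open>g\<close> converge uniformly, and the contraction controls the means of
  \<open>f - g\<close> uniformly in \<open>N\<close>.\<close>

lemma fejer_mean_L1_limit:
  assumes f: "integrable circle_measure f"
  shows "(\<lambda>N. LINT x|circle_measure. norm (fejer_mean N f x - f x)) \<longlonglongrightarrow> 0"
proof (rule LIMSEQ_I)
  fix e :: real assume e: "e > 0"
  obtain g where g: "continuous_on (sphere 0 1) g" "(LINT x|circle_measure. norm (f x - g x)) < e / 3"
    using continuous_dense_L1_circle[OF f, of "e / 3"] e by auto
  have gi: "integrable circle_measure g" by (intro continuous_integrable_circle g)
  have "\<forall>\<^sub>F N in sequentially. \<forall>x\<in>sphere 0 1. dist (fejer_mean N g x) (g x) < e / 3"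
    using e by (intro uniform_limitD[OF fejer_mean_uniform_limit[OF g(1)]]) auto
  then obtain N0 where N0: "\<And>N x. N \<ge> N0 \<Longrightarrow> norm x = 1 \<Longrightarrow> norm (fejer_mean N g x - g x) < e / 3"
    unfolding eventually_sequentially dist_norm by (metis mem_sphere_0)
  show "\<exists>no. \<forall>N\<ge>no. norm ((LINT x|circle_measure. norm (fejer_mean N f x - f x)) - 0) < e"
  proof (intro exI[of _ "max 1 N0"] allI impI)
    fix N assume "N \<ge> max 1 N0"
    hence N: "N > 0" "N \<ge> N0" by auto
    note i = f gi integrable_fejer_mean
    have "(LINT x|circle_measure. norm (fejer_mean N f x - f x)) \<le>
      (LINT x|circle_measure. norm (fejer_mean N (\<lambda>x. f x - g x) x) + (e / 3 + norm (f x - g x)))"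
    proof (intro integral_mono integrable_norm Bochner_Integration.integrable_add Bochner_Integration.integrable_diff i)
      fix x assume "x \<in> space circle_measure"
      hence "norm (fejer_mean N g x - g x) < e / 3" using N0[OF N(2)] by simp
      moreover have eq: "fejer_mean N f x - f x = fejer_mean N (\<lambda>x. f x - g x) x + ((fejer_mean N g x - g x) - (f x - g x))"
        by (simp add: fejer_mean_diff f gi)
      ultimately show "norm (fejer_mean N f x - f x) \<le> norm (fejer_mean N (\<lambda>x. f x - g x) x) + (e / 3 + norm (f x - g x))"
        unfolding eq
        using norm_triangle_ineq[of "fejer_mean N (\<lambda>x. f x - g x) x" "(fejer_mean N g x - g x) - (f x - g x)"]
          norm_triangle_ineq4[of "fejer_mean N g x - g x" "f x - g x"] by linarith
    qed auto
    also have "\<dots> = (LINT x|circle_measure. norm (fejer_mean N (\<lambda>x. f x - g x) x)) + 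
        ((LINT x|circle_measure. e / 3) + (LINT x|circle_measure. norm (f x - g x)))"
      by (subst Bochner_Integration.integral_add Bochner_Integration.integral_add;
          (intro integrable_norm Bochner_Integration.integrable_add Bochner_Integration.integrable_diff i)?; simp)+
    also have "\<dots> \<le> (LINT x|circle_measure. norm (f x - g x)) + (e / 3 + (LINT x|circle_measure. norm (f x - g x)))"
      by (intro add_mono fejer_mean_L1_contraction N Bochner_Integration.integrable_diff i) auto
    also have "\<dots> < e" using g(2) by simp
    finally show "norm ((LINT x|circle_measure. norm (fejer_mean N f x - f x)) - 0) < e"
      by simp
  qed
qed

section \<open>The algebra of bounded analytic functions\<close>

lemma Linf_circle_integrable: "f \<in> Linf_circle \<Longrightarrow> integrable circle_measure f"
  unfolding Linf_circle_def by (auto intro: circle.integrable_const_bound)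

lemma L2_circle_integrable:
  assumes "f \<in> L2_circle"
  shows "integrable circle_measure f"
proof (rule Bochner_Integration.integrable_bound)
  show "integrable circle_measure (\<lambda>z. 1 + (norm (f z))\<^sup>2)"
    using assms by (auto simp: L2_circle_def)
  show "f \<in> borel_measurable circle_measure"
    using assms by (auto simp: L2_circle_def)
  have "t \<le> 1 + t\<^sup>2" for t :: real
    using zero_le_power2[of "t - 1 / 2"] by (simp add: power2_eq_square algebra_simps)
  moreover have "norm (1 + t\<^sup>2) = 1 + t\<^sup>2" for t :: real
    by simp
  ultimately show "AE z in circle_measure. norm (f z) \<le> norm (1 + (norm (f z))\<^sup>2)"
    by (intro AE_I2) (simp only:)
qed

lemma continuous_Linf_circle: "continuous_on (sphere 0 1) f \<Longrightarrow> f \<in> Linf_circle"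
proof -
  assume c: "continuous_on (sphere 0 1) f"
  have "bounded (f ` sphere 0 1)"
    by (intro compact_imp_bounded compact_continuous_image c) auto
  then obtain B where "\<forall>z\<in>sphere 0 1. norm (f z) \<le> B" by (auto simp: bounded_iff)
  thus ?thesis using continuous_measurable_circle[OF c] by (auto simp: Linf_circle_def intro!: exI[of _ B] AE_I2)
qed

lemma continuous_L2_circle: "continuous_on (sphere 0 1) f \<Longrightarrow> f \<in> L2_circle"
  unfolding L2_circle_def
  by (auto intro!: continuous_measurable_circle continuous_integrable_circle continuous_intros)

lemma fourier_coeff_cong_AE:
  assumes "f \<in> borel_measurable circle_measure" "g \<in> borel_measurable circle_measure"
    "AE z in circle_measure. f z = g z"
  shows "fourier_coeff f n = fourier_coeff g n"
  unfolding fourier_coeff_def using assms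
  by (intro integral_cong_AE borel_measurable_times assms(1,2)
      continuous_measurable_circle[OF continuous_powi_circle]) auto

text \<open>Powers of \<open>z\<close> have modulus 1 on the circle, so each coefficient is
  1-Lipschitz for the L1 norm. This is how vanishing negative coefficients survive limits.\<close>

lemma fourier_coeff_L1_limit:
  assumes f: "\<And>N. integrable circle_measure (f N)" and g: "integrable circle_measure g"
    and lim: "(\<lambda>N. LINT z|circle_measure. norm (f N z - g z)) \<longlonglongrightarrow> 0"
  shows "(\<lambda>N. fourier_coeff (f N) n) \<longlonglongrightarrow> fourier_coeff g n"
proof (rule LIM_zero_cancel, rule Lim_null_comparison[OF always_eventually lim], rule allI)
  fix N
  have "fourier_coeff (f N) n - fourier_coeff g n = fourier_coeff (\<lambda>z. f N z - g z) n"
    by (rule fourier_coeff_diff[OF f g, symmetric])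
  also have "\<dots> = (LINT z|circle_measure. (f N z - g z) * z powi - n)"
    by (rule fourier_coeff_def)
  also have "norm \<dots> \<le> (LINT z|circle_measure. norm (f N z - g z))"
    by (intro Bochner_Integration.integral_norm_bound_integral integrable_mult_powi_circle
         integrable_norm Bochner_Integration.integrable_diff f g) (auto simp: norm_mult norm_powi_unit)
  finally show "norm (fourier_coeff (f N) n - fourier_coeff g n) \<le> (LINT z|circle_measure. norm (f N z - g z))" .
qed

text \<open>For \<open>n < 0\<close> the factor \<open>z powi (- n)\<close> is a monomial vanishing
  at 0, so the mean value property at 0 yields 0.\<close>

lemma fourier_coeff_holomorphic:
  assumes "continuous_on (cball 0 1) g" "g holomorphic_on ball 0 1" "n < 0"
  shows "fourier_coeff g n = 0"
proof -
  have "fourier_coeff g n = (LINT z|circle_measure. g z * z ^ nat (- n))"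
    using assms(3) by (simp add: fourier_coeff_def power_int_def)
  also have "\<dots> = g 0 * 0 ^ nat (- n)"
    by (subst mean_value_circle) (use assms in \<open>auto intro!: continuous_intros holomorphic_intros\<close>)
  finally show ?thesis using assms(3) by simp
qed

lemma holomorphic_Hinf:
  assumes "continuous_on (cball 0 1) g" "g holomorphic_on ball 0 1"
  shows "g \<in> Hinf"
  using continuous_Linf_circle[OF continuous_on_subset[OF assms(1) sphere_cball]]
    fourier_coeff_holomorphic[OF assms] by (auto simp: Hinf_def)

text \<open>The terms of \<open>fejer_mean\<close> with \<open>l \<le> k\<close>, written with
  natural powers so that they form a polynomial on the whole plane. The omitted terms carry
  coefficients of negative index only.\<close>

definition fejer_poly :: "nat \<Rightarrow> (complex \<Rightarrow> complex) \<Rightarrow> complex \<Rightarrow> complex" where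
  "fejer_poly N f z = (\<Sum>k<N. \<Sum>l\<le>k. fourier_coeff f (int (k - l)) * z ^ (k - l)) / of_nat N"

lemma fejer_poly_eq:
  assumes "\<forall>n<0. fourier_coeff f n = 0"
  shows "fejer_mean N f z = fejer_poly N f z"
  unfolding fejer_mean_def fejer_poly_def
proof (intro arg_cong2[where f = "(/)"] refl, rule sum.cong[OF refl])
  fix k assume k: "k \<in> {..<N}"
  show "(\<Sum>l<N. fourier_coeff f (int k - int l) * z powi (int k - int l)) =
      (\<Sum>l\<le>k. fourier_coeff f (int (k - l)) * z ^ (k - l))"
    using k assms
    by (intro sum.mono_neutral_cong_right) (auto simp: of_nat_diff[symmetric] simp del: of_nat_diff)
qed

lemma fejer_poly_holomorphic: "fejer_poly N f holomorphic_on A"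
  unfolding fejer_poly_def by (cases "N = 0") (auto intro!: holomorphic_intros)

text \<open>If \<open>f\<close> is a polynomial, the coefficients of \<open>f * g\<close> are finite
  combinations of coefficients of \<open>g\<close> at smaller or equal indices. The general case
  follows by replacing \<open>f\<close> with its Fejer polynomials, the bound on \<open>g\<close>
  preserving L1 convergence.\<close>

lemma fourier_coeff_mult_analytic:
  assumes f: "integrable circle_measure f" "\<forall>n<0. fourier_coeff f n = 0"
    and g: "g \<in> Linf_circle" "\<forall>n<0. fourier_coeff g n = 0" and n: "n < 0"
  shows "fourier_coeff (\<lambda>z. f z * g z) n = 0"
proof -
  have gi: "integrable circle_measure g" using g by (intro Linf_circle_integrable)
  have gm: "g \<in> borel_measurable circle_measure" using gi by simp
  obtain B where B: "AE z in circle_measure. norm (g z) \<le> B" using g by (auto simp: Linf_circle_def)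
  have mult: "integrable circle_measure (\<lambda>z. h z * g z)" if "integrable circle_measure h" for h
  proof (rule Bochner_Integration.integrable_bound[where f = "\<lambda>z. B * norm (h z)"])
    show "AE z in circle_measure. norm (h z * g z) \<le> norm (B * norm (h z))"
      using B
    proof eventually_elim
      case (elim z)
      hence "norm (g z) \<le> \<bar>B\<bar>" by simp
      thus ?case by (simp add: norm_mult abs_mult mult.commute mult_right_mono)
    qed
  qed (use that gm in auto)
  have lim: "(\<lambda>N. fourier_coeff (\<lambda>z. fejer_mean N f z * g z) n) \<longlonglongrightarrow> fourier_coeff (\<lambda>z. f z * g z) n"
  proof (rule fourier_coeff_L1_limit)
    have l0: "(\<lambda>N. B * (LINT x|circle_measure. norm (fejer_mean N f x - f x))) \<longlonglongrightarrow> 0"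
      using tendsto_mult_left[OF fejer_mean_L1_limit[OF f(1)], of B] by simp
    show "(\<lambda>N. LINT z|circle_measure. norm (fejer_mean N f z * g z - f z * g z)) \<longlonglongrightarrow> 0"
    proof (rule Lim_null_comparison[OF always_eventually l0], rule allI)
      fix N
      have "(LINT z|circle_measure. norm (fejer_mean N f z * g z - f z * g z)) \<le>
          (LINT z|circle_measure. B * norm (fejer_mean N f z - f z))"
      proof (rule integral_mono_AE)
        show "AE z in circle_measure. norm (fejer_mean N f z * g z - f z * g z) \<le> B * norm (fejer_mean N f z - f z)"
          using B
        proof eventually_elim
          case (elim z)
          have "norm (fejer_mean N f z * g z - f z * g z) = norm (g z) * norm (fejer_mean N f z - f z)"
            by (metis left_diff_distrib norm_mult mult.commute)
          with elim show ?case by (simp add: mult_right_mono)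
        qed
      qed (intro integrable_norm integrable_mult_right Bochner_Integration.integrable_diff mult f integrable_fejer_mean)+
      thus "norm (LINT z|circle_measure. norm (fejer_mean N f z * g z - f z * g z)) \<le>
         B * (LINT x|circle_measure. norm (fejer_mean N f x - f x))" by simp
    qed
  qed (intro mult f integrable_fejer_mean)+
  have "fourier_coeff (\<lambda>z. fejer_mean N f z * g z) n = 0" for N
  proof -
    have "fourier_coeff (\<lambda>z. fejer_mean N f z * g z) n =
      (LINT z|circle_measure. (\<Sum>k<N. \<Sum>l\<le>k. fourier_coeff f (int (k - l)) * (g z * z powi - (n - int (k - l)))) / of_nat N)"
      unfolding fejer_poly_eq[OF f(2)]
      unfolding fourier_coeff_def[of "\<lambda>z. fejer_poly N f z * g z"]
      unfolding fejer_poly_def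
      unfolding times_divide_eq_left sum_distrib_right
    proof (intro Bochner_Integration.integral_cong refl arg_cong2[where f = "(/)"] sum.cong)
      fix z :: complex and k l assume "z \<in> space circle_measure"
      hence "z \<noteq> 0" by auto
      hence "z powi - (n - int (k - l)) = z ^ (k - l) * z powi - n"
        using power_int_add[of z "int (k - l)" "- n"] by (simp add: power_int_of_nat)
      thus "fourier_coeff f (int (k - l)) * z ^ (k - l) * g z * z powi - n =
         fourier_coeff f (int (k - l)) * (g z * z powi - (n - int (k - l)))" by simp
    qed
    also have "\<dots> = (\<Sum>k<N. \<Sum>l\<le>k. fourier_coeff f (int (k - l)) * fourier_coeff g (n - int (k - l))) / of_nat N"
      unfolding fourier_coeff_def[of g]
      by (simp add: Bochner_Integration.integral_sum integrable_mult_powi_circle gi del: of_nat_diff)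
    \<comment> \<open>As \<open>k - l\<close> is a natural number, \<open>n - int (k - l)\<close> is
      still negative.\<close>
    also have "\<dots> = 0" using g n by simp
    finally show ?thesis .
  qed
  with lim show ?thesis by (simp add: LIMSEQ_const_iff)
qed

lemma Hinf_mult:
  assumes f: "f \<in> Hinf" and g: "g \<in> Hinf"
  shows "(\<lambda>z. f z * g z) \<in> Hinf"
proof -
  obtain A B where A: "AE z in circle_measure. norm (f z) \<le> A" and B: "AE z in circle_measure. norm (g z) \<le> B"
    using f g by (auto simp: Hinf_def Linf_circle_def)
  from A B have "AE z in circle_measure. norm (f z * g z) \<le> A * B"
  proof eventually_elim
    case (elim z)
    have "0 \<le> A" using norm_ge_zero elim(1) by (rule order_trans)
    with elim show ?case unfolding norm_mult by (intro mult_mono) auto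
  qed
  moreover have "(\<lambda>z. f z * g z) \<in> borel_measurable circle_measure"
    using f g by (intro borel_measurable_times) (auto simp: Hinf_def Linf_circle_def)
  ultimately have "(\<lambda>z. f z * g z) \<in> Linf_circle"
    unfolding Linf_circle_def by blast
  moreover have "\<forall>n<0. fourier_coeff (\<lambda>z. f z * g z) n = 0"
    using f g by (intro allI impI fourier_coeff_mult_analytic) (simp_all add: Hinf_def Linf_circle_integrable)
  ultimately show ?thesis by (simp add: Hinf_def)
qed

lemma norm_exp_diff_le:
  fixes a b :: complex
  assumes "Re a \<le> M" "Re b \<le> M"
  shows "norm (exp a - exp b) \<le> exp M * norm (a - b)"
proof (rule field_differentiable_bound[where S = "{z. Re z \<le> M}" and f' = exp])
  show "convex {z. Re z \<le> M}" by (rule convex_halfspace_Re_le)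
qed (use assms in \<open>auto intro!: derivative_eq_intros\<close>)

text \<open>A weighted average with nonnegative weights of total mass 1 respects one-sided
  bounds.\<close>

lemma Re_fejer_mean_le:
  assumes N: "N > 0" and z: "norm z = 1" and f: "integrable circle_measure f"
    and le: "\<And>x. norm x = 1 \<Longrightarrow> Re (f x) \<le> M"
  shows "Re (fejer_mean N f z) \<le> M"
proof -
  note i = fejer_mean_kernel[OF z f] and K = fejer_kernel_integral[OF N z]
  have "Re (fejer_mean N f z) = (LINT x|circle_measure. fejer_kernel N z x * Re (f x))"
    unfolding i(2) integral_Re[OF i(1), symmetric] by simp
  also have "\<dots> \<le> (LINT x|circle_measure. fejer_kernel N z x * M)"
    using le integrable_Re[OF i(1)] K
    by (intro integral_mono) (auto intro!: mult_left_mono fejer_kernel_nonneg)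
  also have "\<dots> = M" using K by simp
  finally show ?thesis .
qed

text \<open>The exponentials of the Fejer polynomials are entire, so their negative coefficients
  vanish. All the real parts stay below \<open>M\<close>, so \<open>norm_exp_diff_le\<close> turns
  L1 convergence of the polynomials into L1 convergence of their exponentials.\<close>

lemma Hinf_exp:
  assumes F: "F \<in> H2" and le: "\<And>x. norm x = 1 \<Longrightarrow> Re (F x) \<le> M"
  shows "(\<lambda>z. exp (F z)) \<in> Hinf"
proof -
  have Fm [measurable]: "F \<in> borel_measurable circle_measure" using F by (auto simp: H2_def L2_circle_def)
  have Fi: "integrable circle_measure F" using F by (auto simp: H2_def L2_circle_integrable)
  have bd: "norm (exp (F z)) \<le> exp M" if "norm z = 1" for z using le[OF that] by simp
  have em: "(\<lambda>z. exp (F z)) \<in> borel_measurable circle_measure"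
    by (rule measurable_compose[OF Fm]) (auto intro!: borel_measurable_continuous_onI continuous_intros)
  have L: "(\<lambda>z. exp (F z)) \<in> Linf_circle"
    unfolding Linf_circle_def using bd em by (auto intro!: AE_I2 exI[of _ "exp M"])
  \<comment> \<open>\<open>Suc N\<close> skips the empty mean at 0, whose kernel does not have
    integral 1.\<close>
  define P where "P N z = fejer_poly (Suc N) F z" for N z
  have P: "P N z = fejer_mean (Suc N) F z" for N z
    unfolding P_def using F by (subst fejer_poly_eq) (auto simp: H2_def)
  have cont: "continuous_on A (P N)" and hol: "P N holomorphic_on A" for A N
    unfolding P_def using holomorphic_on_imp_continuous_on fejer_poly_holomorphic by blast+
  have ci: "integrable circle_measure (\<lambda>z. exp (P N z))" for N
    by (intro continuous_integrable_circle continuous_intros cont)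
  have "fourier_coeff (\<lambda>z. exp (F z)) n = 0" if n: "n < 0" for n
  proof -
    have "(\<lambda>N. fourier_coeff (\<lambda>z. exp (P N z)) n) \<longlonglongrightarrow> fourier_coeff (\<lambda>z. exp (F z)) n"
    proof (rule fourier_coeff_L1_limit)
      have l0: "(\<lambda>N. exp M * (LINT x|circle_measure. norm (P N x - F x))) \<longlonglongrightarrow> 0"
        unfolding P using tendsto_mult_left[OF LIMSEQ_Suc[OF fejer_mean_L1_limit[OF Fi]], of "exp M"] by simp
      show "(\<lambda>N. LINT z|circle_measure. norm (exp (P N z) - exp (F z))) \<longlonglongrightarrow> 0"
      proof (rule Lim_null_comparison[OF always_eventually l0], rule allI)
        fix N
        have "(LINT z|circle_measure. norm (exp (P N z) - exp (F z))) \<le>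
          (LINT z|circle_measure. exp M * norm (P N z - F z))"
        proof (rule integral_mono)
          fix z assume "z \<in> space circle_measure"
          hence z: "norm z = 1" by simp
          show "norm (exp (P N z) - exp (F z)) \<le> exp M * norm (P N z - F z)"
            unfolding P by (intro norm_exp_diff_le Re_fejer_mean_le Fi le z) auto
        qed (intro integrable_norm integrable_mult_right Bochner_Integration.integrable_diff ci Fi 
               continuous_integrable_circle[OF cont] Linf_circle_integrable[OF L])+
        thus "norm (LINT z|circle_measure. norm (exp (P N z) - exp (F z))) \<le>
           exp M * (LINT x|circle_measure. norm (P N x - F x))" by simp
      qed
    qed (intro ci Linf_circle_integrable[OF L])+
    moreover have "fourier_coeff (\<lambda>z. exp (P N z)) n = 0" for N
      by (intro fourier_coeff_holomorphic n continuous_intros cont holomorphic_on_compose[OF hol, unfolded o_def] 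
         holomorphic_intros hol)
    ultimately show ?thesis by (simp add: LIMSEQ_const_iff)
  qed
  thus ?thesis using L by (auto simp: Hinf_def)
qed

text \<open>Every nonempty Fejer mean of such a function equals the constant
  \<open>fourier_coeff f 0\<close>, and the means converge to \<open>f\<close> in L1.\<close>

lemma constant_if_fourier_coeff_zero:
  assumes f: "integrable circle_measure f" and c: "\<And>n. n \<noteq> 0 \<Longrightarrow> fourier_coeff f n = 0"
  shows "AE z in circle_measure. f z = fourier_coeff f 0"
proof -
  have e: "fejer_mean N f z = fourier_coeff f 0" if "N > 0" for N z
  proof -
    have "fejer_mean N f z = (\<Sum>k<N. \<Sum>l<N. if k = l then fourier_coeff f 0 else 0) / N"
      unfolding fejer_mean_def by (intro arg_cong2[where f = "(/)"] sum.cong refl) (auto simp: c)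
    thus ?thesis using that by simp
  qed
  have "(\<lambda>N. LINT x|circle_measure. norm (fejer_mean (Suc N) f x - f x)) \<longlonglongrightarrow> 0"
    by (rule LIMSEQ_Suc[OF fejer_mean_L1_limit[OF f]])
  hence "(LINT x|circle_measure. norm (fourier_coeff f 0 - f x)) = 0"
    by (simp add: e LIMSEQ_const_iff)
  hence "AE x in circle_measure. norm (fourier_coeff f 0 - f x) = 0"
    by (subst (asm) integral_nonneg_eq_0_iff_AE) (auto intro!: integrable_norm Bochner_Integration.integrable_diff f)
  thus ?thesis by eventually_elim auto
qed

lemma fourier_coeff_cnj:
  assumes "integrable circle_measure f"
  shows "fourier_coeff (\<lambda>z. cnj (f z)) n = cnj (fourier_coeff f (- n))"
proof -
  have "cnj (fourier_coeff f (- n)) = (LINT z|circle_measure. cnj (f z * z powi - (- n)))"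
    unfolding fourier_coeff_def
    by (rule integral_bounded_linear[OF bounded_linear_cnj integrable_mult_powi_circle[OF assms], symmetric])
  also have "\<dots> = fourier_coeff (\<lambda>z. cnj (f z)) n"
    unfolding fourier_coeff_def
    by (intro Bochner_Integration.integral_cong) (auto simp: cnj_unit power_int_minus power_int_inverse)
  finally show ?thesis ..
qed

text \<open>The quotient \<open>g = h * D\<close> is unimodular, so its inverse \<open>k * E\<close> is its conjugate;
  as both lie in \<open>Hinf\<close>, only the zeroth Fourier coefficient of \<open>g\<close> survives.\<close>

lemma Hinf_invertible_unique:
  assumes H: "h \<in> Hinf" "k \<in> Hinf" "E \<in> Hinf" "D \<in> Hinf"
    and hk: "AE z in circle_measure. h z * k z = 1"
    and ED: "AE z in circle_measure. E z * D z = 1"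
    and nrm: "AE z in circle_measure. norm (E z) = norm (h z)"
  shows "\<exists>c. norm c = 1 \<and> (AE z in circle_measure. h z = c * E z)"
proof -
  define g where "g z = h z * D z" for z
  have g: "g \<in> Hinf" and kE: "(\<lambda>z. k z * E z) \<in> Hinf"
    unfolding g_def by (intro Hinf_mult H)+
  have gi: "integrable circle_measure g" using g by (auto simp: Hinf_def Linf_circle_integrable)
  have AEg: "AE z in circle_measure. norm (g z) = 1 \<and> cnj (g z) = k z * E z \<and> h z = g z * E z"
    using hk ED nrm
  proof eventually_elim
    case (elim z)
    have n: "norm (g z) = 1" using elim unfolding g_def by (metis norm_mult norm_one)
    have "g z * (k z * E z) = 1" using elim unfolding g_def by (simp add: mult_ac)
    hence "cnj (g z) = k z * E z" using cnj_unit[OF n] by (metis inverse_unique)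
    moreover have "h z = g z * E z" using elim unfolding g_def by (simp add: mult_ac)
    ultimately show ?case using n by simp
  qed
  have "fourier_coeff g n = 0" if "n \<noteq> 0" for n
  proof (cases "n < 0")
    case True thus ?thesis using g by (auto simp: Hinf_def)
  next
    case False
    have "(\<lambda>z. cnj (g z)) \<in> borel_measurable circle_measure"
      by (rule measurable_compose[OF borel_measurable_integrable[OF gi]])
        (intro borel_measurable_continuous_onI continuous_intros)
    hence "fourier_coeff (\<lambda>z. cnj (g z)) (-n) = fourier_coeff (\<lambda>z. k z * E z) (-n)"
      using AEg gi kE by (intro fourier_coeff_cong_AE) (auto simp: Hinf_def Linf_circle_def)
    also have "\<dots> = 0" using kE False that by (auto simp: Hinf_def)
    finally show ?thesis by (simp add: fourier_coeff_cnj[OF gi])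
  qed
  from constant_if_fourier_coeff_zero[OF gi this]
  have c: "AE z in circle_measure. g z = fourier_coeff g 0" .
  have "AE z in circle_measure. norm (fourier_coeff g 0) = 1"
    using c AEg by eventually_elim auto
  \<comment> \<open>The statement does not depend on the point, and the measure is nonzero, so
    holding almost everywhere means holding.\<close>
  hence "norm (fourier_coeff g 0) = 1" 
    using emeasure_circle ae_filter_eq_bot_iff[of circle_measure] by (simp add: eventually_const)
  moreover have "AE z in circle_measure. h z = fourier_coeff g 0 * E z"
    using c AEg by eventually_elim auto
  ultimately show ?thesis by blast
qed

section \<open>Blaschke factorization in the disk algebra\<close>

text \<open>The Fejer polynomials converge uniformly on the circle. The maximum modulus principle
  transfers the Cauchy property to the closed disc, and their uniform limit there is the
  extension.\<close>

lemma disk_algebra_extension: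
  assumes "f \<in> disk_algebra"
  obtains g where "continuous_on (cball 0 1) g" "g holomorphic_on ball 0 1" "\<And>z. norm z = 1 \<Longrightarrow> g z = f z"
proof -
  have c: "continuous_on (sphere 0 1) f" and n: "\<forall>n<0. fourier_coeff f n = 0"
    using assms by (auto simp: disk_algebra_def C_circle_def Hinf_def)
  have u: "uniform_limit (sphere 0 1) (\<lambda>N. fejer_poly N f) f sequentially"
    using fejer_mean_uniform_limit[OF c] by (simp add: fejer_poly_eq[OF n, abs_def])
  have cont: "continuous_on A (fejer_poly N f)" for A N
    using holomorphic_on_imp_continuous_on fejer_poly_holomorphic by blast
  have "uniformly_Cauchy_on (sphere 0 1) (\<lambda>N. fejer_poly N f)"
    using u by (intro uniformly_convergent_Cauchy) (auto simp: uniformly_convergent_on_def)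
  hence "uniformly_Cauchy_on (cball 0 1) (\<lambda>N. fejer_poly N f)"
    unfolding uniformly_Cauchy_on_def
  proof (intro allI impI)
    fix e :: real
    assume U: "\<forall>e>0. \<exists>M. \<forall>x\<in>sphere 0 1. \<forall>m\<ge>M. \<forall>n\<ge>M. dist (fejer_poly m f x) (fejer_poly n f x) < e"
      and e: "e > 0"
    obtain M where M: "\<forall>x\<in>sphere 0 1. \<forall>m\<ge>M. \<forall>n\<ge>M. dist (fejer_poly m f x) (fejer_poly n f x) < e / 2"
      using U half_gt_zero[OF e] by blast
    show "\<exists>M. \<forall>x\<in>cball 0 1. \<forall>m\<ge>M. \<forall>n\<ge>M. dist (fejer_poly m f x) (fejer_poly n f x) < e"
    proof (intro exI[of _ M] ballI allI impI)
      fix x :: complex and m n assume x: "x \<in> cball 0 1" and mn: "m \<ge> M" "n \<ge> M"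
      have le: "norm (fejer_poly m f y - fejer_poly n f y) \<le> e / 2" if "y \<in> frontier (cball 0 1)" for y
        using M mn that by (auto simp: dist_norm intro: less_imp_le)
      have "norm (fejer_poly m f x - fejer_poly n f x) \<le> e / 2"
        by (rule maximum_modulus_frontier[where S = "cball 0 1", OF _ _ _ le x])
          (auto intro!: holomorphic_intros continuous_intros fejer_poly_holomorphic cont)
      thus "dist (fejer_poly m f x) (fejer_poly n f x) < e" using e by (simp add: dist_norm)
    qed
  qed
  then obtain g where g: "uniform_limit (cball 0 1) (\<lambda>N. fejer_poly N f) g sequentially"
    using Cauchy_uniformly_convergent by (auto simp: uniformly_convergent_on_def)
  have hg: "continuous_on (cball 0 1) g" "g holomorphic_on ball 0 1"
    by (rule holomorphic_uniform_limit[OF _ g]; use cont fejer_poly_holomorphic in auto)+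
  have "g z = f z" if "norm z = 1" for z
    using that by (intro LIMSEQ_unique[OF tendsto_uniform_limitI[OF g] tendsto_uniform_limitI[OF u]]) auto
  with hg that show ?thesis by blast
qed

section \<open>Finite Blaschke products\<close>

lemma one_minus_cnj_mult_nonzero:
  fixes a z :: complex
  assumes "norm a < 1" "norm z \<le> 1"
  shows "1 - cnj a * z \<noteq> 0"
proof
  assume "1 - cnj a * z = 0"
  hence "norm (cnj a * z) = 1" by simp
  moreover have "norm (cnj a * z) \<le> norm a * 1"
    unfolding norm_mult using assms by (intro mult_mono) auto
  ultimately show False using assms by simp
qed

lemma norm_blaschke_factor:
  fixes a z :: complex
  assumes "norm a < 1" "norm z = 1"
  shows "norm ((z - a) / (1 - cnj a * z)) = 1"
proof -
  have "1 - cnj a * z = z * cnj (z - a)"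
    using assms(2) complex_norm_square[of z] by (simp add: algebra_simps)
  hence "norm (1 - cnj a * z) = norm (z - a)"
    using assms(2) by (metis complex_mod_cnj mult_1 norm_mult)
  moreover have "z \<noteq> a" using assms by auto
  ultimately show ?thesis by (simp add: norm_divide)
qed

text \<open>Induction on the number of distinct zeros: each step divides out one zero
  \<open>a\<close> with its full multiplicity \<open>n\<close>, so that the quotient has exactly one
  zero fewer.\<close>

lemma blaschke_factorization:
  assumes "finite {z \<in> cball 0 1. f z = 0}" "continuous_on (cball 0 1) f" "f holomorphic_on ball 0 1"
    and "\<forall>z\<in>sphere 0 1. f z \<noteq> 0"
  shows "\<exists>b g. continuous_on (cball 0 1) b \<and> b holomorphic_on ball 0 1 \<and>
    continuous_on (cball 0 1) g \<and> g holomorphic_on ball 0 1 \<and>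
    (\<forall>z\<in>cball 0 1. f z = b z * g z \<and> g z \<noteq> 0) \<and> (\<forall>z\<in>sphere 0 1. norm (b z) = 1)"
  using assms
proof (induction "card {z \<in> cball 0 1. f z = 0}" arbitrary: f)
  case 0
  hence "\<forall>z\<in>cball 0 1. f z \<noteq> 0" by auto
  thus ?case using 0 by (intro exI[of _ "\<lambda>_. 1"] exI[of _ f]) auto
next
  case (Suc m)
  note fin = Suc.prems(1) and cf = Suc.prems(2) and hf = Suc.prems(3)
  have nz: "f z \<noteq> 0" if "norm z = 1" for z using Suc.prems(4) that by simp
  obtain a where a: "norm a \<le> 1" "f a = 0"
    using Suc.hyps(2) by (metis (mono_tags, lifting) card_eq_0_iff emptyE mem_Collect_eq mem_cball_0 nat.distinct(1) subsetI subset_antisym)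
  have a1: "norm a < 1" using a nz[of a] by fastforce
  have aB: "a \<in> ball 0 1" using a1 by simp
  have nc: "\<not> f constant_on ball 0 1"
  proof
    assume "f constant_on ball 0 1"
    hence "ball 0 1 \<subseteq> {z \<in> cball 0 1. f z = 0}" using a a1 by (force simp: constant_on_def)
    moreover have "infinite (ball (0::complex) 1)"
      using uncountable_ball[of 1 "0::complex"] countable_finite by auto
    ultimately show False using fin finite_subset by blast
  qed
  obtain g r n where g: "0 < n" "0 < r" "ball a r \<subseteq> ball 0 1" "g holomorphic_on ball a r"
     "\<And>w. w \<in> ball a r \<Longrightarrow> f w = (w - a) ^ n * g w" "\<And>w. w \<in> ball a r \<Longrightarrow> g w \<noteq> 0"
    by (rule holomorphic_factor_zero_nonconstant[OF hf open_ball connected_ball aB a(2) nc]) (rule that)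
  define B where "B z = ((z - a) / (1 - cnj a * z)) ^ n" for z
  \<comment> \<open>The value at \<open>a\<close> removes the singularity: near \<open>a\<close> one
    has \<open>f z = (z - a) ^ n * g z\<close>, so the quotient by \<open>B\<close> is
    \<open>g z * (1 - cnj a * z) ^ n\<close>.\<close>
  define G where "G z = (if z = a then g a * (1 - cnj a * a) ^ n else f z / B z)" for z
  have den: "1 - cnj a * z \<noteq> 0" if "norm z \<le> 1" for z
    using one_minus_cnj_mult_nonzero[OF a1 that] .
  have cB: "continuous_on (cball 0 1) B" and hB: "B holomorphic_on ball 0 1"
    unfolding B_def using den by (auto intro!: continuous_intros holomorphic_intros)
  have B0: "B z \<noteq> 0" if "norm z \<le> 1" "z \<noteq> a" for z
    using that den by (simp add: B_def)
  have Ga: "G z = g z * (1 - cnj a * z) ^ n" if "z \<in> ball a r" for z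
    using g(5)[OF that] that by (auto simp: G_def B_def power_divide)
  have hG1: "G holomorphic_on (ball 0 1 - {a})"
  proof (rule holomorphic_transform)
    show "(\<lambda>z. f z / B z) holomorphic_on (ball 0 1 - {a})"
      using B0 by (intro holomorphic_intros holomorphic_on_subset[OF hf] holomorphic_on_subset[OF hB]) auto
  qed (auto simp: G_def)
  have hG2: "G holomorphic_on ball a r"
    by (rule holomorphic_transform[of "\<lambda>z. g z * (1 - cnj a * z) ^ n"]) (auto intro!: holomorphic_intros g simp: Ga)
  have "G holomorphic_on (ball 0 1 - {a}) \<union> ball a r"
    by (intro holomorphic_on_Un hG1 hG2) auto
  moreover have "(ball 0 1 - {a}) \<union> ball a r = ball 0 1" using g by auto
  ultimately have hG: "G holomorphic_on ball 0 1" by simp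
  have cG1: "continuous_on (cball 0 1 - {a}) G"
  proof (rule continuous_on_eq)
    show "continuous_on (cball 0 1 - {a}) (\<lambda>z. f z / B z)"
      using B0 by (intro continuous_intros continuous_on_subset[OF cf] continuous_on_subset[OF cB]) auto
  qed (auto simp: G_def)
  \<comment> \<open>Holomorphy gives continuity inside the disc and the quotient formula gives it
    away from \<open>a\<close>; both pieces are relatively open in the closed disc, so they can be
    glued.\<close>
  have eq: "(cball 0 1 - {a}) \<union> ball 0 1 = cball 0 (1::real)" using a1 by auto
  have "continuous_on ((cball 0 1 - {a}) \<union> ball 0 1) G"
  proof (rule continuous_on_Un_local_open)
    show "openin (top_of_set (cball 0 1 - {a} \<union> ball 0 1)) (cball 0 1 - {a})"
      unfolding eq openin_open by (rule exI[of _ "- {a}"]) auto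
    show "openin (top_of_set (cball 0 1 - {a} \<union> ball 0 1)) (ball 0 1)"
      unfolding eq openin_open by (rule exI[of _ "ball 0 1"]) auto
  qed (use cG1 hG holomorphic_on_imp_continuous_on in auto)
  hence cG: "continuous_on (cball 0 1) G" by (simp only: eq)
  have Gf: "f z = B z * G z" if "norm z \<le> 1" for z
    using B0[OF that] a g(1) by (auto simp: G_def B_def)
  have G0: "G z = 0 \<longleftrightarrow> f z = 0 \<and> z \<noteq> a" if "norm z \<le> 1" for z
    using B0[OF that] g(6)[of a] g(2) den[of a] a1 by (auto simp: G_def)
  have eqz: "{z \<in> cball 0 1. G z = 0} = {z \<in> cball 0 1. f z = 0} - {a}"
    using G0 by auto
  have cardG: "m = card {z \<in> cball 0 1. G z = 0}"
    unfolding eqz using Suc.hyps(2) a by (subst card_Diff_singleton) auto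
  have finG: "finite {z \<in> cball 0 1. G z = 0}" unfolding eqz using fin by simp
  have nzG: "\<forall>z\<in>sphere 0 1. G z \<noteq> 0" using G0 nz by simp
  obtain b h where bh: "continuous_on (cball 0 1) b" "b holomorphic_on ball 0 1"
    "continuous_on (cball 0 1) h" "h holomorphic_on ball 0 1"
    "\<forall>z\<in>cball 0 1. G z = b z * h z \<and> h z \<noteq> 0" "\<forall>z\<in>sphere 0 1. norm (b z) = 1"
    using Suc.hyps(1)[OF cardG finG cG hG nzG] by (elim exE conjE) (rule that)
  have nB: "\<forall>z\<in>sphere 0 1. norm (B z * b z) = 1"
    using bh(6) norm_blaschke_factor[OF a1] by (simp add: B_def norm_mult norm_power)
  have fBh: "\<forall>z\<in>cball 0 1. f z = B z * b z * h z \<and> h z \<noteq> 0"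
    using Gf bh(5) by simp
  have "continuous_on (cball 0 1) (\<lambda>z. B z * b z)" "(\<lambda>z. B z * b z) holomorphic_on ball 0 1"
    by (intro continuous_on_mult cB bh(1), intro holomorphic_on_mult hB bh(2))
  with bh(3,4) nB fBh show ?case by blast
qed

lemma disk_algebra_factorization:
  assumes "f \<in> disk_algebra" "\<forall>z\<in>sphere 0 1. f z \<noteq> 0"
  obtains b g where "continuous_on (cball 0 1) b" "b holomorphic_on ball 0 1"
    "continuous_on (cball 0 1) g" "g holomorphic_on ball 0 1" "\<And>z. norm z \<le> 1 \<Longrightarrow> g z \<noteq> 0"
    "\<And>z. norm z = 1 \<Longrightarrow> f z = b z * g z \<and> norm (b z) = 1"
proof -
  obtain F where F: "continuous_on (cball 0 1) F" "F holomorphic_on ball 0 1" "\<And>z. norm z = 1 \<Longrightarrow> F z = f z"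
    using disk_algebra_extension[OF assms(1)] by blast
  let ?Z = "{z \<in> cball 0 1. F z = 0}"
  have nz: "F z \<noteq> 0" if "norm z = 1" for z using F(3) assms(2) that by simp
  \<comment> \<open>The zeros form a compact subset of the open disc, where a nonconstant
    holomorphic function has only finitely many. A constant function with a zero would, by
    continuity, vanish at the boundary point 1.\<close>
  have "finite ?Z"
  proof (cases "?Z = {}")
    case False
    then obtain a where a: "norm a \<le> 1" "F a = 0" by auto
    have "\<not> F constant_on ball 0 1"
    proof
      assume "F constant_on ball 0 1"
      moreover have "a \<in> ball 0 1" using a nz[of a] by (force simp: order_le_less)
      ultimately have "\<forall>x\<in>ball 0 1. F x = 0" using a(2) by (metis constant_on_def)
      hence "F 1 = 0"
        by (intro continuous_constant_on_closure[of "ball 0 1" F 0 1]) (use F in auto)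
      thus False using nz[of 1] by simp
    qed
    moreover have "compact ?Z"
      unfolding compact_eq_bounded_closed
      by (intro conjI continuous_closed_preimage_constant F bounded_subset[OF bounded_cball[of 0 1]]) auto
    moreover have "?Z \<subseteq> ball 0 1" using nz by (force simp: order_le_less)
    ultimately have "finite {z \<in> ?Z. F z = 0}"
      using F(2) by (intro holomorphic_compact_finite_zeros[of F "ball 0 1"]) auto
    thus ?thesis by simp
  next
    case True
    thus ?thesis by (simp only: finite.emptyI)
  qed
  moreover have "\<forall>z\<in>sphere 0 1. F z \<noteq> 0" using nz by simp
  ultimately have "\<exists>b g. continuous_on (cball 0 1) b \<and> b holomorphic_on ball 0 1 \<and>
    continuous_on (cball 0 1) g \<and> g holomorphic_on ball 0 1 \<and>
    (\<forall>z\<in>cball 0 1. F z = b z * g z \<and> g z \<noteq> 0) \<and> (\<forall>z\<in>sphere 0 1. norm (b z) = 1)"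
    using F(1,2) by (intro blaschke_factorization)
  then
  obtain b g where *: "continuous_on (cball 0 1) b" "b holomorphic_on ball 0 1"
    "continuous_on (cball 0 1) g" "g holomorphic_on ball 0 1"
    "\<forall>z\<in>cball 0 1. F z = b z * g z \<and> g z \<noteq> 0" "\<forall>z\<in>sphere 0 1. norm (b z) = 1" by (elim exE conjE) (rule that)
  show ?thesis by (rule that[OF *(1-4)]) (use * F(3) in auto)
qed

section \<open>The unimodular representative\<close>

lemma mult_H2_self:
  assumes "f \<in> borel_measurable circle_measure"
  shows "f \<in> mult_H2 f"
proof -
  have "(\<lambda>_. 1) \<in> H2"
    using holomorphic_Hinf[of "\<lambda>_. 1"] by (simp add: H2_def Hinf_def continuous_L2_circle)
  hence "(\<lambda>z. f z * 1) \<in> {\<lambda>z. f z * h z | h. h \<in> H2}"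
    by (intro CollectI exI[of _ "\<lambda>_. 1"]) simp
  thus ?thesis using assms unfolding mult_H2_def ae_closure_def by auto
qed

locale unimodular_equivalent =
  fixes \<phi> \<theta> :: "complex \<Rightarrow> complex"
  assumes phi: "\<phi> \<in> C_circle" "\<forall>z \<in> sphere 0 1. \<phi> z \<noteq> 0"
    and theta: "unimodular \<theta>"
    and eq: "mult_H2 \<phi> = mult_H2 \<theta>"
begin

lemma phi_cont: "continuous_on (sphere 0 1) \<phi>"
  using phi by (simp add: C_circle_def)

lemma phi_measurable: "\<phi> \<in> borel_measurable circle_measure"
  by (intro continuous_measurable_circle phi_cont)

lemma theta_measurable: "\<theta> \<in> borel_measurable circle_measure"
  using theta by (simp add: unimodular_def)

lemma theta_norm: "AE z in circle_measure. norm (\<theta> z) = 1"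
  using theta by (simp add: unimodular_def)

text \<open>Because 1 lies in \<open>H2\<close>, \<theta> belongs to its own space, which is also
  that of \<phi>; hence the quotient by \<phi> agrees almost everywhere with a member of
  \<open>H2\<close>. It is bounded since \<theta> is unimodular and \<phi> is bounded away from 0.
  The other quotient is symmetric.\<close>

lemma quotient_Hinf: "(\<lambda>z. \<theta> z / \<phi> z) \<in> Hinf" "(\<lambda>z. \<phi> z / \<theta> z) \<in> Hinf"
proof -
  have *: "(\<lambda>z. f z / g z) \<in> Hinf"
    if fg: "f \<in> mult_H2 g" and L: "(\<lambda>z. f z / g z) \<in> Linf_circle" and nz: "AE z in circle_measure. g z \<noteq> 0" for f g
  proof -
    obtain h where h: "h \<in> H2" "AE z in circle_measure. f z = g z * h z"
      using fg unfolding mult_H2_def ae_closure_def by auto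
    have "AE z in circle_measure. f z / g z = h z" using h(2) nz by eventually_elim auto
    hence "fourier_coeff (\<lambda>z. f z / g z) n = fourier_coeff h n" for n
      using L h(1) by (intro fourier_coeff_cong_AE) (simp_all add: Linf_circle_def H2_def L2_circle_def)
    thus ?thesis using h(1) L by (simp add: H2_def Hinf_def)
  qed
  have C: "(\<lambda>z. 1 / \<phi> z) \<in> Linf_circle" "\<phi> \<in> Linf_circle"
    using phi(2) by (auto intro!: continuous_Linf_circle continuous_intros phi_cont)
  have L1: "(\<lambda>z. \<theta> z / \<phi> z) \<in> Linf_circle"
  proof -
    obtain B where "AE z in circle_measure. norm (1 / \<phi> z) \<le> B" using C by (auto simp: Linf_circle_def)
    hence "AE z in circle_measure. norm (\<theta> z / \<phi> z) \<le> B"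
      using theta_norm by eventually_elim (simp add: norm_divide)
    thus ?thesis using theta_measurable phi_measurable
      unfolding Linf_circle_def by (blast intro: borel_measurable_divide)
  qed
  have L2: "(\<lambda>z. \<phi> z / \<theta> z) \<in> Linf_circle"
  proof -
    obtain B where "AE z in circle_measure. norm (\<phi> z) \<le> B" using C by (auto simp: Linf_circle_def)
    hence "AE z in circle_measure. norm (\<phi> z / \<theta> z) \<le> B"
      using theta_norm by eventually_elim (simp add: norm_divide)
    thus ?thesis using theta_measurable phi_measurable
      unfolding Linf_circle_def by (blast intro: borel_measurable_divide)
  qed
  show "(\<lambda>z. \<theta> z / \<phi> z) \<in> Hinf"
    using phi(2) by (intro * L1) (auto simp: eq mult_H2_self theta_measurable intro: AE_I2)
  show "(\<lambda>z. \<phi> z / \<theta> z) \<in> Hinf"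
  proof (intro * L2)
    show "AE z in circle_measure. \<theta> z \<noteq> 0" using theta_norm by eventually_elim auto
  qed (simp add: eq[symmetric] mult_H2_self phi_measurable)
qed

lemma theta_eq:
  assumes E: "E \<in> Hinf" "D \<in> Hinf" "\<And>z. norm z = 1 \<Longrightarrow> E z * D z = 1"
    "\<And>z. norm z = 1 \<Longrightarrow> norm (\<phi> z * E z) = 1"
  obtains c where "norm c = 1" "AE z in circle_measure. \<theta> z = c * (\<phi> z * E z)"
proof -
  have nz: "AE z in circle_measure. \<phi> z \<noteq> 0" using phi(2) by (auto intro: AE_I2)
  have "\<exists>c. norm c = 1 \<and> (AE z in circle_measure. \<theta> z / \<phi> z = c * E z)"
  proof (rule Hinf_invertible_unique[OF quotient_Hinf E(1,2)])
    show "AE z in circle_measure. \<theta> z / \<phi> z * (\<phi> z / \<theta> z) = 1"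
      using theta_norm nz by eventually_elim auto
    show "AE z in circle_measure. E z * D z = 1" using E(3) by (auto intro: AE_I2)
    have "AE z in circle_measure. norm (\<phi> z * E z) = 1" using E(4) by (auto intro: AE_I2)
    thus "AE z in circle_measure. norm (E z) = norm (\<theta> z / \<phi> z)"
      using theta_norm nz by eventually_elim (simp add: norm_mult norm_divide field_simps)
  qed
  then obtain c where c: "norm c = 1" "AE z in circle_measure. \<theta> z / \<phi> z = c * E z" by blast
  have "AE z in circle_measure. \<theta> z = c * (\<phi> z * E z)"
    using c(2) nz by eventually_elim (simp add: field_simps)
  with c(1) that show ?thesis by blast
qed

lemma theta_eq_harmonic_conjugate:
  assumes v: "harmonic_conjugate (\<lambda>z. - ln (norm (\<phi> z))) v"
  obtains c where "norm c = 1" "AE z in circle_measure. \<theta> z =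
    c * (\<phi> z / complex_of_real (norm (\<phi> z)) * exp (\<i> * complex_of_real (v z)))"
proof -
  define F where "F z = complex_of_real (- ln (norm (\<phi> z))) + \<i> * complex_of_real (v z)" for z
  have F: "F \<in> H2" using v by (simp add: harmonic_conjugate_def F_def[abs_def])
  \<comment> \<open>The inverse \<open>exp (- F z)\<close> has to lie in \<open>Hinf\<close> as
    well; \<open>ln (norm (\<phi> z))\<close> is bounded on both sides, so \<open>Hinf_exp\<close>
    serves for either sign.\<close>
  hence mF: "(\<lambda>z. - F z) \<in> H2"
    by (auto simp: H2_def L2_circle_def fourier_coeff_def)
  have "continuous_on (sphere 0 1) (\<lambda>z. ln (norm (\<phi> z)))"
    using phi(2) by (intro continuous_intros phi_cont) auto
  hence "bounded ((\<lambda>z. ln (norm (\<phi> z))) ` sphere 0 1)"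
    by (intro compact_imp_bounded compact_continuous_image) auto
  then obtain M where M: "\<forall>z\<in>sphere 0 1. \<bar>ln (norm (\<phi> z))\<bar> \<le> M" by (auto simp: bounded_iff)
  have E: "(\<lambda>z. exp (F z)) \<in> Hinf" "(\<lambda>z. exp (- F z)) \<in> Hinf"
    by (rule Hinf_exp[OF F, of M] Hinf_exp[OF mF, of M]; use M in \<open>fastforce simp: F_def abs_le_iff\<close>)+
  have pe: "\<phi> z * exp (F z) = \<phi> z / complex_of_real (norm (\<phi> z)) * exp (\<i> * complex_of_real (v z))" if "norm z = 1" for z
    unfolding F_def exp_add exp_of_real using phi(2) that by (simp add: exp_minus divide_inverse)
  obtain c where c: "norm c = 1" "AE z in circle_measure. \<theta> z = c * (\<phi> z * exp (F z))"
  proof (rule theta_eq[OF E])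
    show "norm (\<phi> z * exp (F z)) = 1" if "norm z = 1" for z
      unfolding pe[OF that] using phi(2) that by (simp add: norm_mult norm_divide)
  qed (simp_all add: exp_minus)
  have "AE z in circle_measure. norm z = 1" by (auto intro: AE_I2)
  with c(2) have "AE z in circle_measure. \<theta> z =
    c * (\<phi> z / complex_of_real (norm (\<phi> z)) * exp (\<i> * complex_of_real (v z)))"
    by eventually_elim (simp add: pe)
  with c(1) that show ?thesis by blast
qed

lemma theta_disk_algebra:
  assumes "\<phi> \<in> disk_algebra"
  shows "\<theta> \<in> ae_closure disk_algebra"
proof -
  obtain b g where b: "continuous_on (cball 0 1) b" "b holomorphic_on ball 0 1"
    and g: "continuous_on (cball 0 1) g" "g holomorphic_on ball 0 1" "\<And>z. norm z \<le> 1 \<Longrightarrow> g z \<noteq> 0"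
    and bg: "\<And>z. norm z = 1 \<Longrightarrow> \<phi> z = b z * g z \<and> norm (b z) = 1"
    using disk_algebra_factorization[OF assms phi(2)] by metis
  obtain c where c: "norm c = 1" "AE z in circle_measure. \<theta> z = c * (\<phi> z * (1 / g z))"
  proof (rule theta_eq)
    show "(\<lambda>z. 1 / g z) \<in> Hinf" "g \<in> Hinf"
      using g by (auto intro!: holomorphic_Hinf continuous_intros holomorphic_intros)
  qed (use g(3) bg in \<open>auto simp: norm_mult norm_divide\<close>)
  have "AE z in circle_measure. norm z = 1" by (auto intro: AE_I2)
  with c(2) have "AE z in circle_measure. \<theta> z = c * b z"
    by eventually_elim (use bg g(3) in simp)
  moreover have "(\<lambda>z. c * b z) \<in> disk_algebra"
    unfolding disk_algebra_def C_circle_def using b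
    by (intro IntI CollectI holomorphic_Hinf continuous_on_mult_left holomorphic_on_mult holomorphic_on_const
        continuous_on_subset[OF b(1) sphere_cball])
  ultimately show ?thesis
    unfolding ae_closure_def using theta_measurable by (intro CollectI conjI bexI[of _ "\<lambda>z. c * b z"])
qed
end

section \<open>Conjugates of Hoelder functions\<close>

lemma uniform_limit_L1:
  assumes f: "\<And>N. continuous_on (sphere 0 1) (f N)" and g: "continuous_on (sphere 0 1) g"
    and u: "uniform_limit (sphere 0 1) f g sequentially"
  shows "(\<lambda>N. LINT z|circle_measure. norm (f N z - g z :: complex)) \<longlonglongrightarrow> 0"
proof (rule tendstoI)
  fix e :: real assume e: "e > 0"
  have "\<forall>\<^sub>F N in sequentially. \<forall>z\<in>sphere 0 1. dist (f N z) (g z) < e / 2"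
    using e by (intro uniform_limitD[OF u]) auto
  thus "\<forall>\<^sub>F N in sequentially. dist (LINT z|circle_measure. norm (f N z - g z)) 0 < e"
  proof eventually_elim
    case (elim N)
    have "(LINT z|circle_measure. norm (f N z - g z)) \<le> (LINT z|circle_measure. e / 2)"
      using elim by (intro integral_mono continuous_integrable_circle continuous_intros f g)
        (auto simp: dist_norm intro: less_imp_le)
    moreover have "(LINT z|circle_measure. norm (f N z - g z)) \<ge> 0" by simp
    ultimately show ?case using e by (simp add: dist_real_def del: integral_nonneg)
  qed
qed

text \<open>A rotation multiplies each monomial by a constant, and only the monomial of degree 0 has
  a nonzero integral. The claim therefore holds for Fejer means and passes to their uniform
  limit.\<close>

lemma circle_integral_rotate:
  fixes f :: "complex \<Rightarrow> complex"
  assumes w: "norm w = 1" and f: "continuous_on (sphere 0 1) f"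
  shows "(LINT z|circle_measure. f (w * z)) = (LINT z|circle_measure. f z)"
proof -
  have im: "(\<lambda>z. w * z) ` sphere 0 1 \<subseteq> sphere 0 1" using w by (auto simp: norm_mult)
  have rot: "continuous_on (sphere 0 1) (\<lambda>z. h (w * z))" if "continuous_on (sphere 0 1) h" for h :: "complex \<Rightarrow> complex"
    by (rule continuous_on_compose2[OF that _ im]) (intro continuous_intros)
  have "(\<lambda>N. fourier_coeff (\<lambda>z. fejer_mean N f (w * z)) 0) \<longlonglongrightarrow> fourier_coeff (\<lambda>z. f (w * z)) 0"
  proof (rule fourier_coeff_L1_limit)
    show "(\<lambda>N. LINT z|circle_measure. norm (fejer_mean N f (w * z) - f (w * z))) \<longlonglongrightarrow> 0"
      using fejer_mean_uniform_limit[OF f] w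
      by (intro uniform_limit_L1 rot f continuous_fejer_mean)
         (auto simp: uniform_limit_iff norm_mult elim!: eventually_mono)
  qed (intro continuous_integrable_circle rot f continuous_fejer_mean)+
  hence "(\<lambda>N. fourier_coeff (\<lambda>z. fejer_mean (Suc N) f (w * z)) 0) \<longlonglongrightarrow> fourier_coeff (\<lambda>z. f (w * z)) 0"
    by (rule LIMSEQ_Suc)
  moreover have "fourier_coeff (\<lambda>z. fejer_mean (Suc N) f (w * z)) 0 = fourier_coeff f 0" for N
  proof -
    have "(LINT z|circle_measure. fejer_mean (Suc N) f (w * z)) =
      (\<Sum>k<Suc N. \<Sum>l<Suc N. fourier_coeff f (int k - int l) * w powi (int k - int l) *
          (LINT z|circle_measure. z powi (int k - int l))) / of_nat (Suc N)"
      unfolding fejer_mean_def power_int_mult_distrib mult.assoc[symmetric]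
      by (simp add: Bochner_Integration.integral_sum continuous_integrable_circle continuous_intros
            del: sum.lessThan_Suc of_nat_Suc)
    also have "\<dots> = (\<Sum>k<Suc N. \<Sum>l<Suc N. if k = l then fourier_coeff f 0 else 0) / of_nat (Suc N)"
      by (intro arg_cong2[where f = "(/)"] sum.cong refl) (auto simp: integral_powi_circle)
    also have "\<dots> = fourier_coeff f 0" by (simp del: sum.lessThan_Suc of_nat_Suc)
    finally show ?thesis by (simp add: fourier_coeff_def)
  qed
  ultimately show ?thesis by (simp add: LIMSEQ_const_iff fourier_coeff_def)
qed

lemma continuous_fejer_kernel [continuous_intros]: "continuous_on A (fejer_kernel N z)"
  unfolding fejer_kernel_def by (cases "N = 0") (auto intro!: continuous_intros)

text \<open>The kernel depends only on \<open>z * cnj x\<close>, so a rotation of the variable moves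
  \<open>z\<close> out of the kernel and into \<open>f\<close>.\<close>

lemma fejer_mean_convolution:
  assumes z: "norm z = 1" and f: "continuous_on (sphere 0 1) f"
  shows "fejer_mean N f z = (LINT x|circle_measure. of_real (fejer_kernel N 1 x) * f (z * x))"
    and "continuous_on (sphere 0 1) (\<lambda>x. of_real (fejer_kernel N 1 x) * f (z * x))"
proof -
  have eq: "fejer_kernel N z (z * x) = fejer_kernel N 1 x" for x
  proof -
    have "z * cnj (z * x) = 1 * cnj x"
      using z complex_norm_square[of z] by (simp flip: mult.assoc)
    thus ?thesis unfolding fejer_kernel_def by (simp only:)
  qed
  have "fejer_mean N f z = (LINT x|circle_measure. of_real (fejer_kernel N z x) * f x)"
    by (intro fejer_mean_kernel z continuous_integrable_circle f)
  also have "\<dots> = (LINT x|circle_measure. of_real (fejer_kernel N z (z * x)) * f (z * x))"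
    by (rule circle_integral_rotate[symmetric, OF z]) (intro continuous_intros f)
  finally show "fejer_mean N f z = (LINT x|circle_measure. of_real (fejer_kernel N 1 x) * f (z * x))"
    by (simp only: eq)
  have im: "(\<lambda>x. z * x) ` sphere 0 1 \<subseteq> sphere 0 1" using z by (auto simp: norm_mult)
  show "continuous_on (sphere 0 1) (\<lambda>x. of_real (fejer_kernel N 1 x) * f (z * x))"
    by (intro continuous_intros continuous_on_compose2[OF f _ im])
qed

text \<open>The mean is an average of rotated copies of \<open>f\<close>, and rotations preserve
  distances; so the constant \<open>K\<close> is kept for every \<open>N\<close>.\<close>

lemma fejer_mean_hoelder:
  assumes N: "N > 0" and f: "continuous_on (sphere 0 1) f"
    and hoelder: "\<And>z w. norm z = 1 \<Longrightarrow> norm w = 1 \<Longrightarrow> norm (f z - f w) \<le> K * norm (z - w) powr \<alpha>"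
    and zw: "norm z = 1" "norm w = 1"
  shows "norm (fejer_mean N f z - fejer_mean N f w) \<le> K * norm (z - w) powr \<alpha>"
proof -
  note K = fejer_kernel_integral[OF N norm_one]
  note c = fejer_mean_convolution[OF zw(1) f] fejer_mean_convolution[OF zw(2) f]
  have "fejer_mean N f z - fejer_mean N f w =
     (LINT x|circle_measure. of_real (fejer_kernel N 1 x) * f (z * x) - of_real (fejer_kernel N 1 x) * f (w * x))"
    unfolding c(1,3) by (intro Bochner_Integration.integral_diff[symmetric] continuous_integrable_circle c)
  also have "norm \<dots> \<le> (LINT x|circle_measure. fejer_kernel N 1 x * (K * norm (z - w) powr \<alpha>))"
  proof (rule Bochner_Integration.integral_norm_bound_integral)
    show "integrable circle_measure (\<lambda>x. of_real (fejer_kernel N 1 x) * f (z * x) - of_real (fejer_kernel N 1 x) * f (w * x))"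
      by (intro Bochner_Integration.integrable_diff continuous_integrable_circle c)
    show "integrable circle_measure (\<lambda>x. fejer_kernel N 1 x * (K * norm (z - w) powr \<alpha>))"
      using K by simp
    fix x assume "x \<in> space circle_measure"
    hence x: "norm x = 1" by simp
    have "norm (of_real (fejer_kernel N 1 x) * f (z * x) - of_real (fejer_kernel N 1 x) * f (w * x)) =
        fejer_kernel N 1 x * norm (f (z * x) - f (w * x))"
      by (simp add: norm_mult fejer_kernel_nonneg flip: right_diff_distrib)
    also have "\<dots> \<le> fejer_kernel N 1 x * (K * norm (z * x - w * x) powr \<alpha>)"
      using zw x by (intro mult_left_mono hoelder fejer_kernel_nonneg) (auto simp: norm_mult)
    also have "norm (z * x - w * x) = norm (z - w)"
      using x by (simp add: norm_mult flip: left_diff_distrib)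
    finally show "norm (of_real (fejer_kernel N 1 x) * f (z * x) - of_real (fejer_kernel N 1 x) * f (w * x))
       \<le> fejer_kernel N 1 x * (K * norm (z - w) powr \<alpha>)" .
  qed
  also have "\<dots> = K * norm (z - w) powr \<alpha>" using K by simp
  finally show ?thesis .
qed

lemma hoelder_small:
  fixes \<alpha> K e :: real
  assumes "\<alpha> > 0" "e > 0"
  obtains d where "d > 0" "\<And>t. 0 \<le> t \<Longrightarrow> t < d \<Longrightarrow> K * t powr \<alpha> < e"
proof -
  \<comment> \<open>\<open>K\<close> may be zero or negative; the denominator is positive in every
    case.\<close>
  define c where "c = e / (\<bar>K\<bar> + 1)"
  have c: "c > 0" unfolding c_def using assms by (intro divide_pos_pos) auto
  show ?thesis
  proof (rule that[of "c powr (1 / \<alpha>)"])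
    show "c powr (1 / \<alpha>) > 0" using c by simp
    fix t :: real assume t: "0 \<le> t" "t < c powr (1 / \<alpha>)"
    have "t powr \<alpha> < (c powr (1 / \<alpha>)) powr \<alpha>" using t assms by (intro powr_less_mono2) auto
    also have "\<dots> = c" using c assms by (simp add: powr_powr)
    finally have "t powr \<alpha> < c" .
    have "K * t powr \<alpha> \<le> \<bar>K\<bar> * t powr \<alpha>" by (intro mult_right_mono) auto
    also have "\<dots> \<le> \<bar>K\<bar> * c" using \<open>t powr \<alpha> < c\<close> by (intro mult_left_mono) auto
    also have "\<dots> < (\<bar>K\<bar> + 1) * c" using c by simp
    also have "\<dots> = e" by (simp add: c_def)
    finally show "K * t powr \<alpha> < e" .
  qed
qed

lemma Lip_circle_continuous:
  assumes "f \<in> Lip_circle \<alpha>" "\<alpha> > 0"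
  shows "continuous_on (sphere 0 1) f"
proof -
  obtain K where K: "\<forall>z\<in>sphere 0 1. \<forall>w\<in>sphere 0 1. norm (f z - f w) \<le> K * norm (z - w) powr \<alpha>"
    using assms by (auto simp: Lip_circle_def)
  show ?thesis
    unfolding continuous_on_iff
  proof (intro ballI allI impI)
    fix x :: complex and e :: real assume x: "x \<in> sphere 0 1" and e: "e > 0"
    obtain d where d: "d > 0" "\<And>t. 0 \<le> t \<Longrightarrow> t < d \<Longrightarrow> K * t powr \<alpha> < e"
      using hoelder_small[OF assms(2) e] by blast
    show "\<exists>d>0. \<forall>x'\<in>sphere 0 1. dist x' x < d \<longrightarrow> dist (f x') (f x) < e"
    proof (intro exI[of _ d] conjI ballI impI)
      fix y assume y: "y \<in> sphere 0 1" "dist y x < d"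
      have "norm (f y - f x) \<le> K * norm (y - x) powr \<alpha>" using x y K by blast
      also have "\<dots> < e" using d(2)[of "norm (y - x)"] y by (simp add: dist_norm)
      finally show "dist (f y) (f x) < e" by (simp add: dist_norm)
    qed (rule d)
  qed
qed

section \<open>Poisson kernel and derivative estimates inside the disc\<close>

lemma cnj_mult_unit_diff: "norm x = 1 \<Longrightarrow> 1 - cnj z * x = x * cnj (x - z)"
  using complex_norm_square[of x] by (simp add: algebra_simps)

lemma norm_one_minus_cnj_mult: "norm x = 1 \<Longrightarrow> norm (1 - cnj z * x) = norm (x - z)"
  by (simp only: cnj_mult_unit_diff norm_mult complex_mod_cnj mult_1)

text \<open>On the circle the Poisson kernel is the Cauchy kernel \<open>x / (x - z)\<close> plus
  \<open>cnj z * x / (1 - cnj z * x)\<close>. The first part reproduces \<open>w z\<close>; the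
  second is analytic in \<open>x\<close> and vanishes at 0, so it contributes nothing.\<close>

lemma poisson_formula:
  assumes w: "continuous_on (cball 0 1) w" "w holomorphic_on ball 0 1" and z: "norm z < 1"
  shows "(LINT x|circle_measure. w x * of_real ((1 - (norm z)\<^sup>2) / (norm (x - z))\<^sup>2)) = w z"
proof -
  have nz: "x - z \<noteq> 0" if "norm x = 1" for x using that z by auto
  note nz' = one_minus_cnj_mult_nonzero[OF z]
  have cs: "continuous_on (sphere 0 1) w" by (rule continuous_on_subset[OF w(1)]) auto
  have c1: "continuous_on (sphere 0 1) (\<lambda>x. w x * (x / (x - z)))"
    using nz by (intro continuous_intros cs) auto
  have c2: "continuous_on (cball 0 1) (\<lambda>x. w x * (cnj z * x / (1 - cnj z * x)))"
    using nz' by (intro continuous_intros w) auto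
  have "((\<lambda>x. w x * (x / (x - z)) / x) has_contour_integral
      2 * pi * \<i> * (LINT x|circle_measure. w x * (x / (x - z)))) (circlepath 0 1)"
    by (rule circle_integral_contour[OF c1])
  hence "((\<lambda>x. w x / (x - z)) has_contour_integral
      2 * pi * \<i> * (LINT x|circle_measure. w x * (x / (x - z)))) (circlepath 0 1)"
    by (rule has_contour_integral_eq) auto
  moreover have "((\<lambda>x. w x / (x - z)) has_contour_integral 2 * of_real pi * \<i> * w z) (circlepath 0 1)"
    using z by (intro Cauchy_integral_circlepath w) auto
  ultimately have "2 * pi * \<i> * (LINT x|circle_measure. w x * (x / (x - z))) = 2 * of_real pi * \<i> * w z"
    by (rule has_contour_integral_unique)
  hence i1: "(LINT x|circle_measure. w x * (x / (x - z))) = w z" by simp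
  have i2: "(LINT x|circle_measure. w x * (cnj z * x / (1 - cnj z * x))) = 0"
    using nz' by (subst mean_value_circle[OF c2]) (auto intro!: holomorphic_intros w)
  have "(LINT x|circle_measure. w x * of_real ((1 - (norm z)\<^sup>2) / (norm (x - z))\<^sup>2)) =
    (LINT x|circle_measure. w x * (x / (x - z)) + w x * (cnj z * x / (1 - cnj z * x)))"
  proof (intro Bochner_Integration.integral_cong refl)
    fix x assume "x \<in> space circle_measure"
    hence x: "norm x = 1" by simp
    have x0: "x \<noteq> 0" using x by auto
    have "x / (x - z) + cnj z * x / (1 - cnj z * x) = x * (1 - z * cnj z) / ((x - z) * (1 - cnj z * x))"
      using nz[OF x] nz'[of x] x by (simp add: divide_simps) (simp add: algebra_simps)
    also have "\<dots> = (1 - z * cnj z) / ((x - z) * cnj (x - z))"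
      unfolding cnj_mult_unit_diff[OF x] using x0 nz[OF x] by (simp add: divide_simps del: complex_cnj_diff)
    also have "\<dots> = of_real ((1 - (norm z)\<^sup>2) / (norm (x - z))\<^sup>2)"
      by (simp only: of_real_divide of_real_diff of_real_1 complex_norm_square)
    finally show "w x * of_real ((1 - (norm z)\<^sup>2) / (norm (x - z))\<^sup>2) = w x * (x / (x - z)) + w x * (cnj z * x / (1 - cnj z * x))"
      by (simp only: distrib_left[symmetric])
  qed
  also have "\<dots> = w z + 0"
    unfolding i1[symmetric] i2[symmetric]
    by (intro Bochner_Integration.integral_add continuous_integrable_circle c1 continuous_on_subset[OF c2]) auto
  finally show ?thesis by simp
qed

text \<open>Since \<open>Re ((1 - cnj z * x) powr \<alpha>) \<ge> cos (\<alpha> * pi / 2) * norm (x - z) powr \<alpha>\<close>, the estimate is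
  read off from the Poisson formula for \<open>(1 - cnj z * x) powr \<alpha>\<close> at \<open>z\<close>.\<close>

lemma integral_norm_powr_le:
  assumes \<alpha>: "0 < \<alpha>" "\<alpha> < 1" and z: "norm z < 1"
  shows "(LINT x|circle_measure. norm (x - z) powr \<alpha> / (norm (x - z))\<^sup>2) \<le>
     (1 - norm z) powr (\<alpha> - 1) / cos (\<alpha> * pi / 2)"
    and "continuous_on (sphere 0 1) (\<lambda>x. norm (x - z) powr \<alpha> / (norm (x - z))\<^sup>2)"
proof -
  define w where "w x = (1 - cnj z * x) powr of_real \<alpha>" for x
  define r where "r = 1 - (norm z)\<^sup>2"
  have nz: "x - z \<noteq> 0" if "norm x = 1" for x using that z by auto
  have pos: "Re (1 - cnj z * x) > 0" if "norm x \<le> 1" for x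
  proof -
    have "Re (cnj z * x) \<le> norm (cnj z * x)" by (rule complex_Re_le_cmod)
    also have "\<dots> \<le> norm z * 1" unfolding norm_mult using that by (intro mult_mono) auto
    finally show ?thesis using z by simp
  qed
  hence np: "1 - cnj z * x \<notin> \<real>\<^sub>\<le>\<^sub>0" if "norm x \<le> 1" for x
    using that by (metis complex_nonpos_Reals_iff not_le)
  have hw: "w holomorphic_on cball 0 1"
    unfolding w_def by (intro holomorphic_intros np) simp
  hence w: "continuous_on (cball 0 1) w" "w holomorphic_on ball 0 1"
    using holomorphic_on_imp_continuous_on holomorphic_on_subset[OF _ ball_subset_cball] by blast+
  have cosp: "cos (\<alpha> * pi / 2) > 0"
    using \<alpha> by (intro cos_gt_zero_pi) (auto simp: less_le_trans[of _ 0])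
  have rp: "r > 0" unfolding r_def using z by (simp add: power_less_one_iff abs_square_less_1)
  show c: "continuous_on (sphere 0 1) (\<lambda>x. norm (x - z) powr \<alpha> / (norm (x - z))\<^sup>2)"
    using nz by (intro continuous_intros) auto
  have cs: "continuous_on (sphere 0 1) w" by (rule continuous_on_subset[OF w(1)]) auto
  have cw: "continuous_on (sphere 0 1) (\<lambda>x. w x * of_real (r / (norm (x - z))\<^sup>2))"
    using nz by (intro continuous_intros cs) auto
  have "r * cos (\<alpha> * pi / 2) * (LINT x|circle_measure. norm (x - z) powr \<alpha> / (norm (x - z))\<^sup>2) =
    (LINT x|circle_measure. r * cos (\<alpha> * pi / 2) * (norm (x - z) powr \<alpha> / (norm (x - z))\<^sup>2))"
    by (rule Bochner_Integration.integral_mult_right_zero[symmetric])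
  also have "\<dots> \<le> (LINT x|circle_measure. Re (w x * of_real (r / (norm (x - z))\<^sup>2)))"
  proof (rule integral_mono)
    fix x assume "x \<in> space circle_measure"
    hence x: "norm x = 1" by simp
    define y where "y = 1 - cnj z * x"
    have "Re y > 0" unfolding y_def by (rule pos) (simp add: x)
    moreover have "norm y = norm (x - z)" unfolding y_def by (rule norm_one_minus_cnj_mult[OF x])
    ultimately have y: "Re y > 0" "norm y = norm (x - z)" "y \<noteq> 0" by auto
    have arg: "\<bar>Im (Ln y)\<bar> < pi / 2" using y Re_Ln_pos_lt by blast
    have "cos (\<alpha> * pi / 2) \<le> cos \<bar>\<alpha> * Im (Ln y)\<bar>"
    proof (rule cos_monotone_0_pi_le)
      show "\<bar>\<alpha> * Im (Ln y)\<bar> \<le> \<alpha> * pi / 2"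
        using mult_left_mono[OF less_imp_le[OF arg], of \<alpha>] \<alpha> by (simp add: abs_mult)
      show "\<alpha> * pi / 2 \<le> pi" using \<alpha> mult_right_mono[of \<alpha> 1 pi] pi_gt_zero by simp
    qed simp
    hence "cos (\<alpha> * pi / 2) * norm y powr \<alpha> \<le> cos (\<alpha> * Im (Ln y)) * norm y powr \<alpha>"
      by (intro mult_right_mono) auto
    also have "\<dots> = Re (w x)"
      using y(3) by (simp add: w_def y_def[symmetric] powr_def Re_exp)
    finally have "cos (\<alpha> * pi / 2) * norm (x - z) powr \<alpha> \<le> Re (w x)" by (simp only: y)
    hence "cos (\<alpha> * pi / 2) * norm (x - z) powr \<alpha> * (r / (norm (x - z))\<^sup>2) \<le> Re (w x) * (r / (norm (x - z))\<^sup>2)"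
      using rp by (intro mult_right_mono) auto
    thus "r * cos (\<alpha> * pi / 2) * (norm (x - z) powr \<alpha> / (norm (x - z))\<^sup>2) \<le> Re (w x * of_real (r / (norm (x - z))\<^sup>2))"
      by (simp add: mult_ac)
  qed (intro integrable_mult_right integrable_Re continuous_integrable_circle c cw)+
  also have "\<dots> = Re (LINT x|circle_measure. w x * of_real (r / (norm (x - z))\<^sup>2))"
    by (intro integral_Re continuous_integrable_circle cw)
  also have "(LINT x|circle_measure. w x * of_real (r / (norm (x - z))\<^sup>2)) = w z"
    unfolding r_def by (rule poisson_formula[OF w z])
  \<comment> \<open>At \<open>x = z\<close> the base \<open>1 - cnj z * x\<close> equals
    \<open>1 - (norm z)\<^sup>2\<close>, that is, \<open>r\<close>.\<close>
  also have "w z = of_real r powr of_real \<alpha>"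
    unfolding w_def r_def of_real_diff complex_norm_square by (simp add: mult.commute)
  also have "Re \<dots> = r powr \<alpha>"
    using rp by (simp add: powr_of_real)
  finally have "(LINT x|circle_measure. norm (x - z) powr \<alpha> / (norm (x - z))\<^sup>2) \<le> r powr \<alpha> / (r * cos (\<alpha> * pi / 2))"
    using rp cosp by (simp add: pos_le_divide_eq mult.commute)
  also have "\<dots> = r powr (\<alpha> - 1) / cos (\<alpha> * pi / 2)"
    using rp by (simp add: powr_diff)
  \<comment> \<open>Here \<open>r = (1 - norm z) * (1 + norm z)\<close> is at least
    \<open>1 - norm z\<close>, and the exponent is negative.\<close>
  also have "\<dots> \<le> (1 - norm z) powr (\<alpha> - 1) / cos (\<alpha> * pi / 2)"
  proof (intro divide_right_mono powr_mono2')
    show "1 - norm z \<le> r" unfolding r_def using z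
      by (simp add: power2_eq_square mult_left_le)
  qed (use \<alpha> z cosp in auto)
  finally show "(LINT x|circle_measure. norm (x - z) powr \<alpha> / (norm (x - z))\<^sup>2) \<le>
     (1 - norm z) powr (\<alpha> - 1) / cos (\<alpha> * pi / 2)" .
qed

text \<open>The second integral vanishes because on the circle its kernel is the conjugate of
  \<open>x / (1 - cnj z * x)\<^sup>2\<close>, which is analytic in \<open>x\<close> with value 0 at
  0. Adding both identities expresses the derivative through \<open>2 * Re (F x)\<close>
  alone.\<close>

lemma deriv_circle_integral:
  assumes F: "F holomorphic_on UNIV" and z: "norm z < 1"
  shows "deriv F z = (LINT x|circle_measure. F x * (x / (x - z)\<^sup>2))"
    and "(LINT x|circle_measure. cnj (F x) * (x / (x - z)\<^sup>2)) = 0"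
proof -
  have cF: "continuous_on A F" for A
    using F holomorphic_on_imp_continuous_on continuous_on_subset by blast
  have nz: "x - z \<noteq> 0" if "norm x = 1" for x using that z by auto
  have c: "continuous_on (sphere 0 1) (\<lambda>x. F x * (x / (x - z)\<^sup>2))"
    using nz by (intro continuous_intros cF) auto
  have "((\<lambda>x. F x * (x / (x - z)\<^sup>2) / x) has_contour_integral
      2 * pi * \<i> * (LINT x|circle_measure. F x * (x / (x - z)\<^sup>2))) (circlepath 0 1)"
    by (rule circle_integral_contour[OF c])
  hence "((\<lambda>x. F x / (x - z)\<^sup>2) has_contour_integral
      2 * pi * \<i> * (LINT x|circle_measure. F x * (x / (x - z)\<^sup>2))) (circlepath 0 1)"
    by (rule has_contour_integral_eq) auto
  hence ci: "contour_integral (circlepath 0 1) (\<lambda>x. F x / (x - z)\<^sup>2) =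
      2 * pi * \<i> * (LINT x|circle_measure. F x * (x / (x - z)\<^sup>2))"
    by (rule contour_integral_unique)
  have "(F has_field_derivative 1 / (2 * of_real pi * \<i>) *
      contour_integral (circlepath 0 1) (\<lambda>x. F x / (x - z)\<^sup>2)) (at z)"
    using z by (intro Cauchy_derivative_integral_circlepath cF holomorphic_on_subset[OF F]) auto
  thus "deriv F z = (LINT x|circle_measure. F x * (x / (x - z)\<^sup>2))"
    unfolding ci by (auto dest: DERIV_imp_deriv)
  note nz' = one_minus_cnj_mult_nonzero[OF z]
  have "(LINT x|circle_measure. cnj (F x) * (x / (x - z)\<^sup>2)) =
    (LINT x|circle_measure. cnj (F x * (x / (1 - cnj z * x)\<^sup>2)))"
  proof (intro Bochner_Integration.integral_cong refl)
    fix x assume "x \<in> space circle_measure"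
    hence x: "norm x = 1" by simp
    have x0: "x \<noteq> 0" using x by auto
    have "cnj (x / (1 - cnj z * x)\<^sup>2) = x / (x - z)\<^sup>2"
      unfolding cnj_mult_unit_diff[OF x] using x0 nz[OF x] cnj_unit[OF x]
      by (simp add: power2_eq_square divide_simps) (simp add: mult.commute)
    thus "cnj (F x) * (x / (x - z)\<^sup>2) = cnj (F x * (x / (1 - cnj z * x)\<^sup>2))"
      by (simp only: complex_cnj_mult)
  qed
  also have "\<dots> = cnj (LINT x|circle_measure. F x * (x / (1 - cnj z * x)\<^sup>2))"
    using nz' by (intro integral_bounded_linear[OF bounded_linear_cnj] continuous_integrable_circle
       continuous_intros cF) auto
  also have "(LINT x|circle_measure. F x * (x / (1 - cnj z * x)\<^sup>2)) = 0"
    using nz' by (subst mean_value_circle)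
      (auto intro!: continuous_intros holomorphic_intros cF holomorphic_on_subset[OF F])
  finally show "(LINT x|circle_measure. cnj (F x) * (x / (x - z)\<^sup>2)) = 0" by simp
qed

text \<open>Only the real part of \<open>F\<close> enters the formula for the derivative, and its
  value at a boundary point \<open>e\<close> may be subtracted because constants integrate to 0. The
  Hoelder bound then weakens the singularity of the kernel, and \<open>integral_norm_powr_le\<close>
  finishes.\<close>

lemma deriv_bound_hoelder:
  assumes \<alpha>: "0 < \<alpha>" "\<alpha> < 1" and z: "norm z < 1" and F: "F holomorphic_on UNIV"
    and hoelder: "\<And>x y. norm x = 1 \<Longrightarrow> norm y = 1 \<Longrightarrow> \<bar>Re (F x) - Re (F y)\<bar> \<le> K * norm (x - y) powr \<alpha>"
    and K: "K \<ge> 0"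
  shows "norm (deriv F z) \<le> 4 * K / cos (\<alpha> * pi / 2) * (1 - norm z) powr (\<alpha> - 1)"
proof -
  have cF: "continuous_on A F" for A
    using F holomorphic_on_imp_continuous_on continuous_on_subset by blast
  have nz: "x - z \<noteq> 0" if "norm x = 1" for x using that z by auto
  \<comment> \<open>The radial projection of \<open>z\<close>, a nearest boundary point; at the
    centre any point works.\<close>
  obtain e where e: "norm e = 1" "z = of_real (norm z) * e"
  proof (cases "z = 0")
    case False
    thus ?thesis by (intro that[of "z / of_real (norm z)"]) (simp_all add: norm_divide)
  qed (use that[of 1] in simp)
  have near: "norm (x - e) \<le> 2 * norm (x - z)" if "norm x = 1" for x
  proof -
    have "z - e = of_real (norm z - 1) * e" using e(2) by (simp add: algebra_simps)
    hence "norm (z - e) = norm (complex_of_real (norm z - 1)) * norm e" by (metis norm_mult)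
    hence "norm (z - e) = 1 - norm z" using e(1) z by (simp only: norm_of_real) simp
    also have "\<dots> \<le> norm (x - z)" using norm_triangle_ineq2[of x z] that by simp
    finally show ?thesis using norm_triangle_ineq[of "x - z" "z - e"] by simp
  qed
  define k where "k x = x / (x - z)\<^sup>2" for x
  have ck: "continuous_on (sphere 0 1) k" unfolding k_def using nz by (intro continuous_intros) auto
  note d1 = deriv_circle_integral[OF F z, folded k_def]
  \<comment> \<open>A constant function has derivative 0.\<close>
  have d2: "(LINT x|circle_measure. c * k x) = 0" for c
    using deriv_circle_integral(1)[of "\<lambda>_. c", OF holomorphic_on_const z, folded k_def] by simp
  have c: "continuous_on (sphere 0 1) (\<lambda>x. F x * k x)" "continuous_on (sphere 0 1) (\<lambda>x. cnj (F x) * k x)"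
    "continuous_on (sphere 0 1) (\<lambda>x. of_real (2 * Re (F e)) * k x)"
    by (intro continuous_intros cF ck)+
  note i = c[THEN continuous_integrable_circle]
  note b = integral_norm_powr_le[OF \<alpha> z]
  have "(LINT x|circle_measure. of_real (2 * (Re (F x) - Re (F e))) * k x) =
     (LINT x|circle_measure. F x * k x + cnj (F x) * k x - of_real (2 * Re (F e)) * k x)"
  proof (intro Bochner_Integration.integral_cong refl)
    fix x
    have "F x * k x + cnj (F x) * k x - of_real (2 * Re (F e)) * k x =
        ((F x + cnj (F x)) - of_real (2 * Re (F e))) * k x"
      by (simp only: distrib_right left_diff_distrib)
    also have "\<dots> = of_real (2 * (Re (F x) - Re (F e))) * k x"
      by (simp only: complex_add_cnj of_real_diff[symmetric] right_diff_distrib)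
    finally show "of_real (2 * (Re (F x) - Re (F e))) * k x =
        F x * k x + cnj (F x) * k x - of_real (2 * Re (F e)) * k x" ..
  qed
  also have "\<dots> = deriv F z"
    using i d1 d2[of "of_real (2 * Re (F e))"] by simp
  finally have "norm (deriv F z) = norm (LINT x|circle_measure. of_real (2 * (Re (F x) - Re (F e))) * k x)"
    by simp
  \<comment> \<open>One factor 2 comes from \<open>2 * Re\<close>, the other from
    \<open>norm (x - e) \<le> 2 * norm (x - z)\<close> together with
    \<open>2 powr \<alpha> \<le> 2\<close>.\<close>
  also have "\<dots> \<le> (LINT x|circle_measure. 4 * K * (norm (x - z) powr \<alpha> / (norm (x - z))\<^sup>2))"
  proof (rule Bochner_Integration.integral_norm_bound_integral)
    show "integrable circle_measure (\<lambda>x. of_real (2 * (Re (F x) - Re (F e))) * k x)"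
      by (intro continuous_integrable_circle continuous_intros cF ck)
    show "integrable circle_measure (\<lambda>x. 4 * K * (norm (x - z) powr \<alpha> / (norm (x - z))\<^sup>2))"
      by (intro integrable_mult_right continuous_integrable_circle b)
    fix x assume "x \<in> space circle_measure"
    hence x: "norm x = 1" by simp
    have "norm (k x) = 1 / (norm (x - z))\<^sup>2"
      using x by (simp add: k_def norm_divide norm_power)
    hence "norm (of_real (2 * (Re (F x) - Re (F e))) * k x) = 2 * \<bar>Re (F x) - Re (F e)\<bar> / (norm (x - z))\<^sup>2"
      by (simp only: norm_mult norm_of_real abs_mult) simp
    also have "\<dots> \<le> 2 * (2 * (K * norm (x - z) powr \<alpha>)) / (norm (x - z))\<^sup>2"
    proof (intro divide_right_mono mult_left_mono)
      have "norm (x - e) powr \<alpha> \<le> (2 * norm (x - z)) powr \<alpha>"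
        using near[OF x] \<alpha> by (intro powr_mono2) auto
      also have "\<dots> = 2 powr \<alpha> * norm (x - z) powr \<alpha>" by (simp add: powr_mult)
      also have "\<dots> \<le> 2 powr 1 * norm (x - z) powr \<alpha>"
        using \<alpha> by (intro mult_right_mono powr_mono) auto
      finally have "norm (x - e) powr \<alpha> \<le> 2 * norm (x - z) powr \<alpha>" by simp
      hence "K * norm (x - e) powr \<alpha> \<le> K * (2 * norm (x - z) powr \<alpha>)"
        using K by (intro mult_left_mono) auto
      with hoelder[OF x e(1)] show "\<bar>Re (F x) - Re (F e)\<bar> \<le> 2 * (K * norm (x - z) powr \<alpha>)" by simp
    qed auto
    finally show "norm (of_real (2 * (Re (F x) - Re (F e))) * k x) \<le> 4 * K * (norm (x - z) powr \<alpha> / (norm (x - z))\<^sup>2)"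
      by simp
  qed
  also have "\<dots> = 4 * K * (LINT x|circle_measure. norm (x - z) powr \<alpha> / (norm (x - z))\<^sup>2)"
    by (rule Bochner_Integration.integral_mult_right_zero)
  also have "\<dots> \<le> 4 * K * ((1 - norm z) powr (\<alpha> - 1) / cos (\<alpha> * pi / 2))"
    using K by (intro mult_left_mono b) auto
  finally show ?thesis by simp
qed

section \<open>From derivative growth to Hoelder continuity on the boundary\<close>

lemma radial_bound:
  assumes \<alpha>: "0 < \<alpha>" and F: "F holomorphic_on UNIV"
    and d: "\<And>z. norm z < 1 \<Longrightarrow> norm (deriv F z) \<le> M * (1 - norm z) powr (\<alpha> - 1)"
    and x: "norm x = 1" and \<rho>: "0 \<le> \<rho>" "\<rho> < 1"
  shows "norm (F x - F (of_real \<rho> * x)) \<le> M / \<alpha> * (1 - \<rho>) powr \<alpha>"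
proof -
  define f where "f t = F (of_real t * x)" for t
  \<comment> \<open>An antiderivative of the majorant
    \<open>M * (1 - t) powr (\<alpha> - 1)\<close>; as \<alpha> is positive it stays continuous up
    to \<open>t = 1\<close>.\<close>
  define g where "g t = - (M / \<alpha>) * (1 - t) powr \<alpha>" for t
  have "norm (f 1 - f \<rho>) \<le> g 1 - g \<rho>"
  proof (rule differentiable_bound_general)
    have cF: "continuous_on UNIV F" using F holomorphic_on_imp_continuous_on by blast
    show "continuous_on {\<rho>..1} f" unfolding f_def
      by (intro continuous_on_compose2[OF cF] continuous_intros) auto
    show "continuous_on {\<rho>..1} g" unfolding g_def
      using \<alpha> by (intro continuous_intros continuous_on_powr') auto
    fix t assume t: "\<rho> < t" "t < 1"
    have "(F has_field_derivative deriv F (of_real t * x)) (at (of_real t * x))"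
      using F by (intro holomorphic_derivI[of _ UNIV]) auto
    hence "((F \<circ> (\<lambda>t. of_real t * x)) has_vector_derivative (x * deriv F (of_real t * x))) (at t)"
      by (intro field_vector_diff_chain_at) (auto intro!: derivative_eq_intros simp: has_vector_derivative_def scaleR_conv_of_real)
    thus "(f has_vector_derivative (x * deriv F (of_real t * x))) (at t)"
      by (simp add: f_def[abs_def] o_def)
    have "(g has_real_derivative M * (1 - t) powr (\<alpha> - 1)) (at t)"
      unfolding g_def using t \<alpha> by (auto intro!: derivative_eq_intros)
    thus "(g has_vector_derivative M * (1 - t) powr (\<alpha> - 1)) (at t)"
      by (simp add: has_real_derivative_iff_has_vector_derivative)
    show "norm (x * deriv F (of_real t * x)) \<le> M * (1 - t) powr (\<alpha> - 1)"
      using d[of "of_real t * x"] t x \<rho> by (simp add: norm_mult)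
  qed (use \<rho> in auto)
  thus ?thesis using x by (simp add: f_def g_def)
qed

text \<open>Go from \<open>x\<close> radially inwards to radius \<open>1 - s\<close>, across to the
  ray of \<open>y\<close>, and out again. With \<open>s\<close> proportional to the distance of
  \<open>x\<close> and \<open>y\<close>, all three pieces are of order
  \<open>s powr \<alpha>\<close>.\<close>

lemma hardy_littlewood:
  assumes \<alpha>: "0 < \<alpha>" "\<alpha> < 1" and F: "F holomorphic_on UNIV"
    and d: "\<And>z. norm z < 1 \<Longrightarrow> norm (deriv F z) \<le> M * (1 - norm z) powr (\<alpha> - 1)"
    and M: "M \<ge> 0" and xy: "norm x = 1" "norm y = 1"
  shows "norm (F x - F y) \<le> (2 * M / \<alpha> + 2 * M) * norm (x - y) powr \<alpha>"
proof (cases "x = y")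
  case False
  \<comment> \<open>Half the chord is at most 1, so the inner radius \<open>1 - s\<close> is not
    negative.\<close>
  define s where "s = norm (x - y) / 2"
  have s: "0 < s" "s \<le> 1"
    unfolding s_def using False norm_triangle_ineq4[of x y] xy by auto
  define \<rho> where "\<rho> = 1 - s"
  have \<rho>: "0 \<le> \<rho>" "\<rho> < 1" "1 - \<rho> = s" using s by (auto simp: \<rho>_def)
  have r: "norm (F w - F (of_real \<rho> * w)) \<le> M / \<alpha> * s powr \<alpha>" if "norm w = 1" for w
    using radial_bound[OF \<alpha>(1) F d that \<rho>(1,2)] unfolding \<rho>(3) .
  have "norm (F (of_real \<rho> * x) - F (of_real \<rho> * y)) \<le> M * s powr (\<alpha> - 1) * norm (of_real \<rho> * x - of_real \<rho> * y)"
  proof (rule field_differentiable_bound[where S = "cball 0 \<rho>" and f = F and f' = "deriv F"])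
    fix z :: complex assume z: "z \<in> cball 0 \<rho>"
    show "(F has_field_derivative deriv F z) (at z within cball 0 \<rho>)"
      by (rule has_field_derivative_at_within, rule holomorphic_derivI[OF F]) auto
    have "norm (deriv F z) \<le> M * (1 - norm z) powr (\<alpha> - 1)" using z \<rho> by (intro d) auto
    also have "\<dots> \<le> M * s powr (\<alpha> - 1)"
      using z \<rho> s \<alpha> M by (intro mult_left_mono powr_mono2') auto
    finally show "norm (deriv F z) \<le> M * s powr (\<alpha> - 1)" .
  qed (use xy \<rho> in \<open>auto simp: norm_mult\<close>)
  also have "norm (of_real \<rho> * x - of_real \<rho> * y) = \<rho> * (2 * s)"
    using \<rho> by (simp add: s_def norm_mult flip: right_diff_distrib)
  also have "M * s powr (\<alpha> - 1) * (\<rho> * (2 * s)) \<le> M * s powr (\<alpha> - 1) * (1 * (2 * s))"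
    using M s \<rho> by (intro mult_left_mono mult_right_mono mult_nonneg_nonneg) auto
  also have "\<dots> = 2 * M * s powr \<alpha>"
    using s by (simp add: powr_diff)
  finally have m: "norm (F (of_real \<rho> * x) - F (of_real \<rho> * y)) \<le> 2 * M * s powr \<alpha>" .
  have "F x - F y = (F x - F (of_real \<rho> * x)) + (F (of_real \<rho> * x) - F (of_real \<rho> * y))
     - (F y - F (of_real \<rho> * y))" by simp
  also have "norm \<dots> \<le> norm (F x - F (of_real \<rho> * x)) + norm (F (of_real \<rho> * x) - F (of_real \<rho> * y))
     + norm (F y - F (of_real \<rho> * y))"
    by (rule order_trans[OF norm_triangle_ineq4 add_right_mono[OF norm_triangle_ineq]])
  also have "\<dots> \<le> M / \<alpha> * s powr \<alpha> + 2 * M * s powr \<alpha> + M / \<alpha> * s powr \<alpha>"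
    by (intro add_mono r m xy)
  also have "\<dots> = (2 * M / \<alpha> + 2 * M) * s powr \<alpha>"
    using \<alpha> by (simp add: field_simps)
  also have "\<dots> \<le> (2 * M / \<alpha> + 2 * M) * norm (x - y) powr \<alpha>"
    using M \<alpha> s by (intro mult_left_mono powr_mono2) (auto simp: s_def)
  finally show ?thesis .
qed simp

section \<open>Analytic completion and Privalov's theorem\<close>

lemma sum_symmetric_matrix:
  fixes a :: "nat \<Rightarrow> nat \<Rightarrow> real"
  assumes "\<And>k l. a k l = a l k"
  shows "(\<Sum>k<N. \<Sum>l<N. a k l) = 2 * (\<Sum>k<N. \<Sum>l\<le>k. a k l) - (\<Sum>k<N. a k k)"
proof (induction N)
  case (Suc N)
  have "(\<Sum>k<Suc N. \<Sum>l<Suc N. a k l) = (\<Sum>k<N. \<Sum>l<N. a k l) + (\<Sum>k<N. a k N) + (\<Sum>l<N. a N l) + a N N"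
    by (simp add: sum.distrib)
  also have "(\<Sum>k<N. a k N) = (\<Sum>l<N. a N l)" by (subst assms) simp
  also have "(\<Sum>k<N. \<Sum>l<N. a k l) = 2 * (\<Sum>k<N. \<Sum>l\<le>k. a k l) - (\<Sum>k<N. a k k)" by (rule Suc)
  also have "(\<Sum>l<N. a N l) = (\<Sum>l\<le>N. a N l) - a N N"
    by (simp add: lessThan_Suc_atMost[symmetric])
  finally show ?case by simp
qed simp

text \<open>For real \<open>u\<close> the coefficients at \<open>n\<close> and \<open>- n\<close>
  are conjugate, so the real parts form a symmetric array. Its full square, the Fejer mean, is twice
  the lower triangle, the polynomial, minus the diagonal, the zeroth coefficient.\<close>

lemma Re_fejer_completion:
  fixes u :: "complex \<Rightarrow> real"
  assumes u: "integrable circle_measure (\<lambda>x. complex_of_real (u x))" and N: "N > 0" and z: "norm z = 1"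
  shows "Re (2 * fejer_poly N (\<lambda>x. of_real (u x)) z - fourier_coeff (\<lambda>x. of_real (u x)) 0) =
     Re (fejer_mean N (\<lambda>x. of_real (u x)) z)"
proof -
  let ?c = "fourier_coeff (\<lambda>x. of_real (u x))"
  define a where "a k l = Re (?c (int k - int l) * z powi (int k - int l))" for k l
  have "a k l = a l k" for k l
  proof -
    have "?c (int l - int k) * z powi (int l - int k) = cnj (?c (int k - int l) * z powi (int k - int l))"
      using fourier_coeff_cnj[OF u, of "int l - int k"] power_int_minus[of z "int k - int l"]
      by (simp add: cnj_unit z power_int_inverse)
    thus ?thesis unfolding a_def by (simp only: cnj.simps)
  qed
  from sum_symmetric_matrix[of a, OF this]
  have "(\<Sum>k<N. \<Sum>l<N. a k l) / N = 2 * ((\<Sum>k<N. \<Sum>l\<le>k. a k l) / N) - (\<Sum>k<N. a k k) / N"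
    by (simp add: diff_divide_distrib)
  moreover have "(\<Sum>k<N. a k k) / N = Re (?c 0)" using N by (simp add: a_def)
  moreover have "(\<Sum>k<N. \<Sum>l<N. a k l) / N = Re (fejer_mean N (\<lambda>x. of_real (u x)) z)"
    unfolding fejer_mean_def a_def by (simp only: Re_divide_of_nat Re_sum)
  moreover have "(\<Sum>k<N. \<Sum>l\<le>k. a k l) / N = Re (fejer_poly N (\<lambda>x. of_real (u x)) z)"
    unfolding fejer_poly_def a_def Re_divide_of_nat Re_sum
    by (intro arg_cong2[where f = "(/)"] refl sum.cong) (auto simp: of_nat_diff[symmetric] simp del: of_nat_diff)
  ultimately show ?thesis by simp
qed

text \<open>The analytic completions of the Fejer means have a common Hoelder constant
  \<open>L\<close> on the circle and a common bound, so Arzela-Ascoli yields a uniformly convergent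
  subsequence. Its limit has real part \<open>u\<close> and no negative coefficients; its imaginary
  part is the conjugate.\<close>

lemma harmonic_conjugate_Lip:
  fixes u :: "complex \<Rightarrow> real"
  assumes \<alpha>: "0 < \<alpha>" "\<alpha> < 1" and u: "(\<lambda>x. complex_of_real (u x)) \<in> Lip_circle \<alpha>"
  obtains v where "harmonic_conjugate u v" "(\<lambda>x. complex_of_real (v x)) \<in> Lip_circle \<alpha>"
proof -
  let ?u = "\<lambda>x. complex_of_real (u x)"
  let ?c = "fourier_coeff ?u 0"
  obtain K0 where K0: "\<forall>x\<in>sphere 0 1. \<forall>y\<in>sphere 0 1. norm (?u x - ?u y) \<le> K0 * norm (x - y) powr \<alpha>"
    using u by (auto simp: Lip_circle_def)
  \<comment> \<open>The constant in \<open>Lip_circle\<close> carries no sign condition, while the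
    derivative estimate asks for a nonnegative one.\<close>
  define K where "K = \<bar>K0\<bar>"
  have K: "norm (?u x - ?u y) \<le> K * norm (x - y) powr \<alpha>" if "norm x = 1" "norm y = 1" for x y
  proof -
    have "norm (?u x - ?u y) \<le> K0 * norm (x - y) powr \<alpha>" using K0 that by simp
    also have "\<dots> \<le> K * norm (x - y) powr \<alpha>" unfolding K_def by (intro mult_right_mono) auto
    finally show ?thesis .
  qed
  have cu: "continuous_on (sphere 0 1) ?u" by (rule Lip_circle_continuous[OF u \<alpha>(1)])
  note ui = continuous_integrable_circle[OF cu]
  define F where "F N z = 2 * fejer_poly (Suc N) ?u z - ?c" for N z
  have hF: "F N holomorphic_on A" for N A
    unfolding F_def by (intro holomorphic_intros fejer_poly_holomorphic)
  hence cF: "continuous_on A (F N)" for N A by (rule holomorphic_on_imp_continuous_on)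
  have ReF: "Re (F N x) = Re (fejer_mean (Suc N) ?u x)" if "norm x = 1" for N x
    unfolding F_def by (intro Re_fejer_completion ui that) simp
  define M where "M = 4 * K / cos (\<alpha> * pi / 2)"
  have "cos (\<alpha> * pi / 2) > 0"
    using \<alpha> by (intro cos_gt_zero_pi) (auto simp: less_le_trans[of _ 0])
  hence M: "M \<ge> 0" unfolding M_def K_def by simp
  have dF: "norm (deriv (F N) z) \<le> M * (1 - norm z) powr (\<alpha> - 1)" if "norm z < 1" for N z
    unfolding M_def
  proof (intro deriv_bound_hoelder \<alpha> that hF)
    fix x y :: complex assume xy: "norm x = 1" "norm y = 1"
    have "\<bar>Re (F N x) - Re (F N y)\<bar> = \<bar>Re (fejer_mean (Suc N) ?u x - fejer_mean (Suc N) ?u y)\<bar>"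
      using xy by (simp add: ReF)
    also have "\<dots> \<le> norm (fejer_mean (Suc N) ?u x - fejer_mean (Suc N) ?u y)" by (rule abs_Re_le_cmod)
    also have "\<dots> \<le> K * norm (x - y) powr \<alpha>" by (intro fejer_mean_hoelder cu K xy) auto
    finally show "\<bar>Re (F N x) - Re (F N y)\<bar> \<le> K * norm (x - y) powr \<alpha>" .
  qed (simp add: K_def)
  define L where "L = 2 * M / \<alpha> + 2 * M"
  have L: "norm (F N x - F N y) \<le> L * norm (x - y) powr \<alpha>" if "norm x = 1" "norm y = 1" for N x y
    unfolding L_def by (intro hardy_littlewood \<alpha> hF dF M that)
  \<comment> \<open>The value at the centre serves twice: it anchors the uniform bound, and as the
    mean of \<open>F N\<close> it normalises the conjugate.\<close>
  have F0: "F N 0 = ?c" for N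
  proof -
    have "fejer_poly (Suc N) ?u 0 = (\<Sum>k<Suc N. \<Sum>l\<le>k. if l = k then ?c else 0) / of_nat (Suc N)"
      unfolding fejer_poly_def by (intro arg_cong2[where f = "(/)"] refl sum.cong) auto
    also have "\<dots> = ?c" by (simp del: of_nat_Suc sum.lessThan_Suc)
    finally show ?thesis by (simp add: F_def)
  qed
  have bd: "norm (F N x) \<le> norm ?c + M / \<alpha>" if "norm x = 1" for N x
  proof -
    have "norm (F N x - F N (of_real 0 * x)) \<le> M / \<alpha> * (1 - 0) powr \<alpha>"
      by (intro radial_bound \<alpha> hF dF that) auto
    hence "norm (F N x - ?c) \<le> M / \<alpha>" by (simp add: F0)
    thus ?thesis using norm_triangle_ineq2[of "F N x" ?c] by simp
  qed
  have "\<exists>g (k :: nat \<Rightarrow> nat). continuous_on (sphere 0 1) g \<and> strict_mono k \<and>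
    (\<forall>e>0. \<exists>N. \<forall>n x. N \<le> n \<and> x \<in> sphere 0 1 \<longrightarrow> norm (F (k n) x - g x) < e)"
  proof (rule Arzela_Ascoli[of "sphere 0 1" F "norm ?c + M / \<alpha>"])
    fix x :: complex and e :: real assume x: "x \<in> sphere 0 1" and e: "0 < e"
    obtain d where d: "d > 0" "\<And>t. 0 \<le> t \<Longrightarrow> t < d \<Longrightarrow> L * t powr \<alpha> < e"
      using hoelder_small[OF \<alpha>(1) e] by blast
    show "\<exists>d>0. \<forall>n y. y \<in> sphere 0 1 \<and> norm (x - y) < d \<longrightarrow> norm (F n x - F n y) < e"
    proof (intro exI[of _ d] conjI allI impI)
      fix n y assume y: "y \<in> sphere 0 1 \<and> norm (x - y) < d"
      have "norm (F n x - F n y) \<le> L * norm (x - y) powr \<alpha>" using x y by (intro L) auto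
      also have "\<dots> < e" using d(2)[of "norm (x - y)"] y by simp
      finally show "norm (F n x - F n y) < e" .
    qed (rule d)
  next
    show "norm (F n x) \<le> norm ?c + M / \<alpha>" if "x \<in> sphere 0 1" for n x
      using bd[of x n] that by simp
  next
    show "\<exists>g (k :: nat \<Rightarrow> nat). continuous_on (sphere 0 1) g \<and> strict_mono k \<and>
        (\<forall>e>0. \<exists>N. \<forall>n x. N \<le> n \<and> x \<in> sphere 0 1 \<longrightarrow> norm (F (k n) x - g x) < e)"
      if "continuous_on (sphere 0 1) h" "strict_mono (r :: nat \<Rightarrow> nat)"
        "\<And>e. 0 < e \<Longrightarrow> \<exists>N. \<forall>n x. N \<le> n \<and> x \<in> sphere 0 1 \<longrightarrow> norm (F (r n) x - h x) < e" for h r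
      by (rule exI[of _ h], rule exI[of _ r]) (use that in simp)
  qed (rule compact_sphere)
  then obtain g and k :: "nat \<Rightarrow> nat" where g: "continuous_on (sphere 0 1) g" "strict_mono k"
    "\<forall>e>0. \<exists>N. \<forall>n x. N \<le> n \<and> x \<in> sphere 0 1 \<longrightarrow> norm (F (k n) x - g x) < e" by (elim exE conjE) (rule that)
  have ul: "uniform_limit (sphere 0 1) (\<lambda>n. F (k n)) g sequentially"
    unfolding uniform_limit_iff eventually_sequentially dist_norm using g(3) by blast
  have lim: "(\<lambda>n. F (k n) x) \<longlonglongrightarrow> g x" if "norm x = 1" for x
    using tendsto_uniform_limitI[OF ul, of x] that by simp
  have Reg: "Re (g x) = u x" if x: "norm x = 1" for x
  proof (rule LIMSEQ_unique)
    show "(\<lambda>n. Re (F (k n) x)) \<longlonglongrightarrow> Re (g x)" by (intro tendsto_intros lim x)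
    have "(\<lambda>n. fejer_mean n ?u x) \<longlonglongrightarrow> ?u x"
      using tendsto_uniform_limitI[OF fejer_mean_uniform_limit[OF cu], of x] x by simp
    hence "(\<lambda>n. fejer_mean (Suc (k n)) ?u x) \<longlonglongrightarrow> ?u x"
      using LIMSEQ_subseq_LIMSEQ[OF LIMSEQ_Suc g(2)] by (simp add: o_def)
    from tendsto_Re[OF this] show "(\<lambda>n. Re (F (k n) x)) \<longlonglongrightarrow> u x"
      using x by (simp add: ReF)
  qed
  have Lg: "norm (g x - g y) \<le> L * norm (x - y) powr \<alpha>" if "norm x = 1" "norm y = 1" for x y
    by (rule LIMSEQ_le_const2[OF tendsto_norm[OF tendsto_diff[OF lim[OF that(1)] lim[OF that(2)]]]])
       (use L that in auto)
  have coeff: "(\<lambda>n. fourier_coeff (F (k n)) m) \<longlonglongrightarrow> fourier_coeff g m" for m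
    by (intro fourier_coeff_L1_limit continuous_integrable_circle cF g uniform_limit_L1 ul)
  have neg: "fourier_coeff g m = 0" if "m < 0" for m
    using coeff[of m] by (simp add: fourier_coeff_holomorphic[OF cF hF that] LIMSEQ_const_iff)
  have "fourier_coeff (F N) 0 = ?c" for N
    using mean_value_circle[OF cF hF, of N] by (simp add: fourier_coeff_def F0)
  with coeff[of 0] have "fourier_coeff g 0 = ?c" by (simp add: LIMSEQ_const_iff)
  \<comment> \<open>The mean of \<open>u\<close> is real, so the imaginary part of \<open>g\<close>
    has mean 0.\<close>
  hence "(LINT x|circle_measure. g x) = complex_of_real (LINT x|circle_measure. u x)"
    by (simp add: fourier_coeff_def)
  hence mean: "(LINT x|circle_measure. Im (g x)) = 0"
    by (simp add: integral_Im continuous_integrable_circle g(1))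
  define v where "v x = Im (g x)" for x
  have uv: "?u x + \<i> * complex_of_real (v x) = g x" if "norm x = 1" for x
    using Reg[OF that] by (simp add: v_def complex_eq_iff)
  have cuv: "continuous_on (sphere 0 1) (\<lambda>x. ?u x + \<i> * complex_of_real (v x))"
    by (rule continuous_on_eq[OF g(1)]) (use uv in simp)
  have "fourier_coeff (\<lambda>x. ?u x + \<i> * complex_of_real (v x)) m = fourier_coeff g m" for m
    unfolding fourier_coeff_def by (intro Bochner_Integration.integral_cong) (use uv in auto)
  hence "(\<lambda>x. ?u x + \<i> * complex_of_real (v x)) \<in> H2"
    using neg by (simp add: H2_def continuous_L2_circle[OF cuv])
  hence "harmonic_conjugate u v"
    unfolding harmonic_conjugate_def using mean
    by (intro conjI continuous_L2_circle cu) (auto simp: v_def[abs_def] intro!: continuous_intros g)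
  moreover have "(\<lambda>x. complex_of_real (v x)) \<in> Lip_circle \<alpha>"
    unfolding Lip_circle_def
  proof (intro CollectI exI[of _ L] ballI)
    fix x y :: complex assume "x \<in> sphere 0 1" "y \<in> sphere 0 1"
    hence "\<bar>Im (g x - g y)\<bar> \<le> L * norm (x - y) powr \<alpha>"
      using abs_Im_le_cmod[of "g x - g y"] Lg[of x y] by simp
    thus "norm (complex_of_real (v x) - complex_of_real (v y)) \<le> L * norm (x - y) powr \<alpha>"
      by (simp add: v_def flip: of_real_diff)
  qed
  ultimately show ?thesis using that by blast
qed

section \<open>Operations on Hoelder functions\<close>

lemma Lip_circle_mult:
  assumes \<alpha>: "\<alpha> > 0" and f: "f \<in> Lip_circle \<alpha>" and g: "g \<in> Lip_circle \<alpha>"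
  shows "(\<lambda>z. f z * g z) \<in> Lip_circle \<alpha>"
proof -
  obtain K L where K: "\<forall>z\<in>sphere 0 1. \<forall>w\<in>sphere 0 1. norm (f z - f w) \<le> K * norm (z - w) powr \<alpha>"
    and L: "\<forall>z\<in>sphere 0 1. \<forall>w\<in>sphere 0 1. norm (g z - g w) \<le> L * norm (z - w) powr \<alpha>"
    using f g by (auto simp: Lip_circle_def)
  have "bounded (f ` sphere 0 1)" "bounded (g ` sphere 0 1)"
    by (intro compact_imp_bounded compact_continuous_image Lip_circle_continuous[OF _ \<alpha>] f g compact_sphere)+
  then obtain A B where A: "A > 0" "\<forall>z\<in>sphere 0 1. norm (f z) \<le> A" and B: "B > 0" "\<forall>z\<in>sphere 0 1. norm (g z) \<le> B"
    by (auto simp: bounded_pos)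
  show ?thesis
    unfolding Lip_circle_def
  proof (intro CollectI exI[of _ "A * L + K * B"] ballI)
    fix z w :: complex assume zw: "z \<in> sphere 0 1" "w \<in> sphere 0 1"
    have "f z * g z - f w * g w = f z * (g z - g w) + (f z - f w) * g w" by (simp add: algebra_simps)
    also have "norm \<dots> \<le> norm (f z) * norm (g z - g w) + norm (f z - f w) * norm (g w)"
      by (metis norm_mult norm_triangle_ineq)
    also have "\<dots> \<le> A * (L * norm (z - w) powr \<alpha>) + (K * norm (z - w) powr \<alpha>) * B"
    proof (intro add_mono mult_mono)
      show "0 \<le> K * norm (z - w) powr \<alpha>" using K zw norm_ge_zero order_trans by blast
    qed (use A B K L zw in auto)
    finally show "norm (f z * g z - f w * g w) \<le> (A * L + K * B) * norm (z - w) powr \<alpha>"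
      by (simp add: algebra_simps)
  qed
qed

lemma Lip_circle_compose:
  assumes f: "f \<in> Lip_circle \<alpha>" 
    and h: "\<And>z w. norm z = 1 \<Longrightarrow> norm w = 1 \<Longrightarrow> norm (h z - h w) \<le> C * norm (f z - f w)" and C: "C \<ge> 0"
  shows "h \<in> Lip_circle \<alpha>"
proof -
  obtain K where K: "\<forall>z\<in>sphere 0 1. \<forall>w\<in>sphere 0 1. norm (f z - f w) \<le> K * norm (z - w) powr \<alpha>"
    using f by (auto simp: Lip_circle_def)
  show ?thesis
    unfolding Lip_circle_def
  proof (intro CollectI exI[of _ "C * K"] ballI)
    fix z w :: complex assume zw: "z \<in> sphere 0 1" "w \<in> sphere 0 1"
    have "norm (h z - h w) \<le> C * norm (f z - f w)" using zw by (intro h) auto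
    also have "\<dots> \<le> C * (K * norm (z - w) powr \<alpha>)" using K zw by (intro mult_left_mono C) auto
    finally show "norm (h z - h w) \<le> C * K * norm (z - w) powr \<alpha>" by simp
  qed
qed

text \<open>The modulus of \<open>f\<close> is bounded away from 0, and there the logarithm is
  Lipschitz: \<open>ln t \<le> t - 1\<close> is applied to the ratio of two moduli, in both
  orders.\<close>

lemma Lip_circle_ln_norm:
  assumes \<alpha>: "\<alpha> > 0" and f: "f \<in> Lip_circle \<alpha>" and nz: "\<forall>z\<in>sphere 0 1. f z \<noteq> 0"
  shows "(\<lambda>z. complex_of_real (- ln (norm (f z)))) \<in> Lip_circle \<alpha>"
proof -
  have "continuous_on (sphere 0 1) (\<lambda>z. inverse (norm (f z)))"
    using nz by (intro continuous_intros Lip_circle_continuous[OF f \<alpha>]) auto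
  hence "bounded ((\<lambda>z. inverse (norm (f z))) ` sphere 0 1)"
    by (intro compact_imp_bounded compact_continuous_image) auto
  then obtain B where B: "B > 0" "\<forall>z\<in>sphere 0 1. inverse (norm (f z)) \<le> B" by (auto simp: bounded_pos)
  have one: "ln (norm (f z)) - ln (norm (f w)) \<le> B * norm (f z - f w)" if "norm z = 1" "norm w = 1" for z w
  proof -
    have p: "norm (f z) > 0" "norm (f w) > 0" using nz that by auto
    have "ln (norm (f z)) - ln (norm (f w)) = ln (norm (f z) / norm (f w))" using p by (simp add: ln_div)
    also have "\<dots> \<le> norm (f z) / norm (f w) - 1" using p by (intro ln_le_minus_one) auto
    also have "\<dots> = inverse (norm (f w)) * (norm (f z) - norm (f w))" using p by (simp add: field_simps)
    also have "\<dots> \<le> inverse (norm (f w)) * norm (f z - f w)"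
      using p by (intro mult_left_mono norm_triangle_ineq2) auto
    also have "\<dots> \<le> B * norm (f z - f w)" using B that by (intro mult_right_mono) auto
    finally show ?thesis .
  qed
  show ?thesis
  proof (rule Lip_circle_compose[OF f _ less_imp_le[OF B(1)]])
    fix z w :: complex assume "norm z = 1" "norm w = 1"
    thus "norm (complex_of_real (- ln (norm (f z))) - complex_of_real (- ln (norm (f w)))) \<le> B * norm (f z - f w)"
      using one[of z w] one[of w z] by (simp add: norm_minus_commute abs_le_iff flip: of_real_diff)
  qed
qed

lemma Lip_circle_exp:
  assumes \<alpha>: "\<alpha> > 0" and f: "f \<in> Lip_circle \<alpha>"
  shows "(\<lambda>z. exp (f z)) \<in> Lip_circle \<alpha>"
proof -
  have "bounded (f ` sphere 0 1)"
    by (intro compact_imp_bounded compact_continuous_image Lip_circle_continuous[OF f \<alpha>] compact_sphere)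
  then obtain B where B: "\<forall>z\<in>sphere 0 1. norm (f z) \<le> B" by (auto simp: bounded_iff)
  have "Re (f z) \<le> B" if "norm z = 1" for z
    using B that complex_Re_le_cmod[of "f z"] by force
  thus ?thesis
    by (intro Lip_circle_compose[OF f, where C = "exp B"] norm_exp_diff_le) auto
qed

lemma Lip_circle_const_mult:
  assumes "f \<in> Lip_circle \<alpha>"
  shows "(\<lambda>z. c * f z) \<in> Lip_circle \<alpha>"
  by (rule Lip_circle_compose[OF assms, where C = "norm c"]) (simp_all add: norm_mult flip: right_diff_distrib)

section \<open>Regularity read off from the formula\<close>

lemma (in unimodular_equivalent) theta_Lip_circle:
  assumes \<alpha>: "0 < \<alpha>" "\<alpha> < 1" and f: "\<phi> \<in> Lip_circle \<alpha>"
  shows "\<theta> \<in> ae_closure (Lip_circle \<alpha>)"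
proof -
  let ?u = "\<lambda>z. - ln (norm (\<phi> z))"
  note Lu = Lip_circle_ln_norm[OF \<alpha>(1) f phi(2)]
  obtain v where v: "harmonic_conjugate ?u v" "(\<lambda>x. complex_of_real (v x)) \<in> Lip_circle \<alpha>"
    using harmonic_conjugate_Lip[OF \<alpha> Lu] by blast
  obtain c where c: "AE z in circle_measure. \<theta> z =
    c * (\<phi> z / complex_of_real (norm (\<phi> z)) * exp (\<i> * complex_of_real (v z)))"
    using theta_eq_harmonic_conjugate[OF v(1)] by blast
  \<comment> \<open>Writing \<open>1 / norm (\<phi> z)\<close> as the exponential of
    \<open>- ln (norm (\<phi> z))\<close> makes every factor a Hoelder function on the
    circle.\<close>
  let ?g = "\<lambda>z. c * (\<phi> z * (exp (complex_of_real (?u z)) * exp (\<i> * complex_of_real (v z))))"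
  have g: "?g \<in> Lip_circle \<alpha>"
    by (intro Lip_circle_const_mult Lip_circle_mult Lip_circle_exp \<alpha> f Lu v)
  have "AE z in circle_measure. norm z = 1" by (auto intro: AE_I2)
  with c have "AE z in circle_measure. \<theta> z = ?g z"
  proof eventually_elim
    case (elim z)
    hence "\<phi> z \<noteq> 0" using phi(2) by simp
    thus ?case using elim unfolding exp_of_real by (simp add: exp_minus divide_inverse)
  qed
  with g theta_measurable show ?thesis
    unfolding ae_closure_def by (intro CollectI conjI bexI[of _ ?g])
qed

lemma (in unimodular_equivalent) theta_C_circle:
  assumes v: "harmonic_conjugate (\<lambda>z. - ln (norm (\<phi> z))) v"
    and vC: "(\<lambda>z. complex_of_real (v z)) \<in> ae_closure C_circle"
  shows "\<theta> \<in> ae_closure C_circle"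
proof -
  obtain c where c: "AE z in circle_measure. \<theta> z =
    c * (\<phi> z / complex_of_real (norm (\<phi> z)) * exp (\<i> * complex_of_real (v z)))"
    using theta_eq_harmonic_conjugate[OF v] by blast
  obtain w where w: "continuous_on (sphere 0 1) w" "AE z in circle_measure. complex_of_real (v z) = w z"
    using vC unfolding ae_closure_def C_circle_def by auto
  \<comment> \<open>The continuous representative \<open>w\<close> is complex-valued and matches
    \<open>v\<close> only almost everywhere; continuity of \<open>exp (\<i> * w z)\<close> and
    almost everywhere equality suffice.\<close>
  let ?g = "\<lambda>z. c * (\<phi> z / complex_of_real (norm (\<phi> z)) * exp (\<i> * w z))"
  have "?g \<in> C_circle"
    unfolding C_circle_def using phi(2) by (auto intro!: continuous_intros phi_cont w(1))
  moreover have "AE z in circle_measure. \<theta> z = ?g z"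
    using c w(2) by eventually_elim simp
  ultimately show ?thesis
    using theta_measurable unfolding ae_closure_def by (intro CollectI conjI bexI[of _ ?g])
qed

theorem proposition4p4:
  fixes \<phi> \<theta> :: "complex \<Rightarrow> complex" and u :: "complex \<Rightarrow> real"
  assumes "\<phi> \<in> C_circle"
    and "\<forall>z \<in> sphere 0 1. \<phi> z \<noteq> 0"
    and "unimodular \<theta>"
    and "\<theta> \<in> QC"
    and "mult_H2 \<phi> = mult_H2 \<theta>"
    and "u = (\<lambda>z. - ln (norm (\<phi> z)))"
  shows "(\<forall>v. harmonic_conjugate u v \<longrightarrow>
            (\<exists>c. norm c = 1 \<and>
              (AE z in circle_measure. \<theta> z = c * (\<phi> z / complex_of_real (norm (\<phi> z)) *
                                      exp (\<i> * complex_of_real (v z))))) \<and>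
            ((\<lambda>z. complex_of_real (v z)) \<in> ae_closure C_circle \<longrightarrow> \<theta> \<in> ae_closure C_circle)) \<and>
         (\<forall>\<alpha>. 0 < \<alpha> \<and> \<alpha> < 1 \<and> \<phi> \<in> Lip_circle \<alpha> \<longrightarrow> \<theta> \<in> ae_closure (Lip_circle \<alpha>)) \<and>
         (\<phi> \<in> disk_algebra \<longrightarrow> \<theta> \<in> ae_closure disk_algebra)"
proof -
  interpret unimodular_equivalent \<phi> \<theta> by unfold_locales (use assms in auto)
  show ?thesis
    unfolding assms(6)
  proof (intro conjI allI impI)
    fix v assume v: "harmonic_conjugate (\<lambda>z. - ln (norm (\<phi> z))) v"
    obtain c where "norm c = 1" "AE z in circle_measure. \<theta> z =
        c * (\<phi> z / complex_of_real (norm (\<phi> z)) * exp (\<i> * complex_of_real (v z)))"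
      using theta_eq_harmonic_conjugate[OF v] .
    thus "\<exists>c. norm c = 1 \<and> (AE z in circle_measure. \<theta> z =
        c * (\<phi> z / complex_of_real (norm (\<phi> z)) * exp (\<i> * complex_of_real (v z))))"
      by (intro exI[of _ c] conjI)
    assume "(\<lambda>z. complex_of_real (v z)) \<in> ae_closure C_circle"
    thus "\<theta> \<in> ae_closure C_circle" by (rule theta_C_circle[OF v])
  next
    fix \<alpha> :: real assume "0 < \<alpha> \<and> \<alpha> < 1 \<and> \<phi> \<in> Lip_circle \<alpha>"
    thus "\<theta> \<in> ae_closure (Lip_circle \<alpha>)" by (intro theta_Lip_circle) auto
  next
    assume "\<phi> \<in> disk_algebra"
    thus "\<theta> \<in> ae_closure disk_algebra" by (rule theta_disk_algebra)
  qed
qed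

end
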